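(* Let $\mathcal{H}$ be an essential and irreducible finite arrangement of complex linear hyperplanes $H=\{h=0\}\subset\mathbb{C}^n$, let $\nabla=d-\sum_{H\in\mathcal{H}}A_H\,dh/h$ be a flat, torsion free, unitary standard connection, and let $g$ be a Kähler metric on $(\mathbb{C}^n)^\circ=\mathbb{C}^n\setminus\bigcup_{H\in\mathcal H}H$ with $\nabla g=0$. Assume that for every $L\in\mathcal{L}_{irr}(\mathcal{H})$ the weight $a_L$ satisfies $a_L\notin\mathbb{Z}$ and $1-a_L>0$. Then the holonomy representation $\pi_1((\mathbb{C}^n)^\circ,p)\to GL(T_p\mathbb{C}^n)$ of $\nabla$ (equivalently, of the flat Kähler metric $g$ on $(\mathbb{C}^n)^\circ$) is irreducible.
   Context: Arrangements. For each $H\in\mathcal{H}$ a linear function $h$ with $H=\{h=0\}$ is fixed. $\mathcal{H}$ is essential if the common intersection of its members is $\{0\}$. $\mathcal{L}(\mathcal{H})$ is the set of all linear subspaces that are intersections of members of $\mathcal{H}$; $\mathcal{H}_L=\{H\in\mathcal{H}:L\subset H\}$. For $\mathcal{B}\subset\mathcal{H}$ let $W(\mathcal{B})\subset(\mathbb{C}^n)^*$ be the span of the linear equations of its members; $\mathcal{B}$ is reducible if it is a union of two non-empty subsets $\mathcal{B}_1,\mathcal{B}_2$ with $W(\mathcal{B})=W(\mathcal{B}_1)\oplus W(\mathcal{B}_2)$ (equivalently, it is linearly isomorphic to a product of two non-empty arrangements), irreducible otherwise. $\mathcal{L}_{irr}(\mathcal{H})$ is the set of $L\in\mathcal{L}(\mathcal{H})$,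 $L\ne\mathbb{C}^n$, with $\mathcal{H}_L$ irreducible. Connections. A standard connection is a meromorphic connection $\nabla=d-\sum_{H}A_H\,dh/h$ on $T\mathbb{C}^n$, in the frame of linear coordinate vector fields, with constant matrices $A_H$. It is flat, torsion free, unitary if it is so on $(\mathbb{C}^n)^\circ$ (unitary: it preserves a positive definite Hermitian inner product). The weight at $L\in\mathcal{L}_{irr}(\mathcal{H})$ is $a_L=(\operatorname{codim}L)^{-1}\sum_{H\in\mathcal{H}_L}\operatorname{tr}A_H$. Irreducible holonomy means that no non-zero proper complex subspace of $T_p\mathbb{C}^n$ is invariant under all holonomies. *)

theory Defs
  imports "HOL-Analysis.Analysis" "HOL-Library.Complex_Order"
begin

section \<open>Linear hyperplane arrangements\<close>

text \<open>An arrangement is a set of hyperplanes together with a chosen linear equation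
  \<open>h H\<close> for each member \<open>H\<close>.\<close>

definition arrangement ::
  "(complex^'n) set set \<Rightarrow> ((complex^'n) set \<Rightarrow> complex^'n \<Rightarrow> complex) \<Rightarrow> bool" where
  "arrangement \<H> h \<longleftrightarrow> finite \<H> \<and>
     (\<forall>H\<in>\<H>. Vector_Spaces.linear (*s) (*) (h H) \<and> h H \<noteq> (\<lambda>x. 0) \<and> H = {x. h H x = 0})"

definition essential :: "(complex^'n) set set \<Rightarrow> bool" where
  "essential \<H> \<longleftrightarrow> \<Inter>\<H> = {0}"

text \<open>The subset \<open>B = {}\<close> contributes the ambient space.\<close>

definition intersection_poset :: "(complex^'n) set set \<Rightarrow> (complex^'n) set set" where
  "intersection_poset \<H> = {\<Inter>B | B. B \<subseteq> \<H>}"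

definition localization :: "(complex^'n) set set \<Rightarrow> (complex^'n) set \<Rightarrow> (complex^'n) set set" where
  "localization \<H> L = {H\<in>\<H>. L \<subseteq> H}"

text \<open>The span, inside the dual space, of the equations of the members of a finite \<open>B\<close>.\<close>

definition equation_span ::
  "((complex^'n) set \<Rightarrow> complex^'n \<Rightarrow> complex) \<Rightarrow> (complex^'n) set set \<Rightarrow> (complex^'n \<Rightarrow> complex) set"
  where "equation_span h B = {f. \<exists>c. f = (\<lambda>x. \<Sum>H\<in>B. c H * h H x)}"

definition is_direct_sum ::
  "('a \<Rightarrow> complex) set \<Rightarrow> ('a \<Rightarrow> complex) set \<Rightarrow> ('a \<Rightarrow> complex) set \<Rightarrow> bool" where
  "is_direct_sum W W1 W2 \<longleftrightarrow>
     W = {\<lambda>x. f x + g x | f g. f \<in> W1 \<and> g \<in> W2} \<and> W1 \<inter> W2 = {\<lambda>x. 0}"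

definition reducible_arrangement ::
  "((complex^'n) set \<Rightarrow> complex^'n \<Rightarrow> complex) \<Rightarrow> (complex^'n) set set \<Rightarrow> bool" where
  "reducible_arrangement h B \<longleftrightarrow>
     (\<exists>B1 B2. B1 \<noteq> {} \<and> B2 \<noteq> {} \<and> B = B1 \<union> B2 \<and>
        is_direct_sum (equation_span h B) (equation_span h B1) (equation_span h B2))"

definition irreducible_arrangement ::
  "((complex^'n) set \<Rightarrow> complex^'n \<Rightarrow> complex) \<Rightarrow> (complex^'n) set set \<Rightarrow> bool" where
  "irreducible_arrangement h B \<longleftrightarrow> \<not> reducible_arrangement h B"

definition irreducible_intersections ::
  "(complex^'n) set set \<Rightarrow> ((complex^'n) set \<Rightarrow> complex^'n \<Rightarrow> complex) \<Rightarrow> (complex^'n) set set" where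
  "irreducible_intersections \<H> h =
     {L \<in> intersection_poset \<H>. L \<noteq> UNIV \<and> irreducible_arrangement h (localization \<H> L)}"

definition complement :: "(complex^'n) set set \<Rightarrow> (complex^'n) set" where
  "complement \<H> = UNIV - \<Union>\<H>"

definition codim :: "(complex^'n) set \<Rightarrow> nat" where
  "codim L = CARD('n) - vec.dim L"

section \<open>Standard connections\<close>

text \<open>Vector fields are written in the frame of coordinate vector fields, hence are functions
  \<open>complex^'n \<Rightarrow> complex^'n\<close>. The value \<open>conn_form \<H> h A x v w\<close> is
  \<open>\<Omega>\<^sub>x(v) w\<close> for the matrix-valued 1-form \<open>\<Omega> = \<Sum> A\<^sub>H dh/h\<close>.\<close>

definition conn_form ::
  "(complex^'n) set set \<Rightarrow> ((complex^'n) set \<Rightarrow> complex^'n \<Rightarrow> complex) \<Rightarrow>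
   ((complex^'n) set \<Rightarrow> complex^'n^'n) \<Rightarrow> complex^'n \<Rightarrow> complex^'n \<Rightarrow> complex^'n \<Rightarrow> complex^'n" where
  "conn_form \<H> h A x v w = (\<Sum>H\<in>\<H>. (h H v / h H x) *s (A H *v w))"

definition holomorphic_field_on :: "(complex^'n) set \<Rightarrow> (complex^'n \<Rightarrow> complex^'n) \<Rightarrow> bool" where
  "holomorphic_field_on U X \<longleftrightarrow>
     (\<forall>x\<in>U. \<exists>D. (X has_derivative D) (at x) \<and> Vector_Spaces.linear (*s) (*s) D)"

definition nabla ::
  "(complex^'n) set set \<Rightarrow> ((complex^'n) set \<Rightarrow> complex^'n \<Rightarrow> complex) \<Rightarrow>
   ((complex^'n) set \<Rightarrow> complex^'n^'n) \<Rightarrow>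
   (complex^'n \<Rightarrow> complex^'n) \<Rightarrow> (complex^'n \<Rightarrow> complex^'n) \<Rightarrow> complex^'n \<Rightarrow> complex^'n" where
  "nabla \<H> h A X Y x = frechet_derivative Y (at x) (X x) - conn_form \<H> h A x (X x) (Y x)"

definition lie_bracket ::
  "(complex^'n \<Rightarrow> complex^'n) \<Rightarrow> (complex^'n \<Rightarrow> complex^'n) \<Rightarrow> complex^'n \<Rightarrow> complex^'n" where
  "lie_bracket X Y x = frechet_derivative Y (at x) (X x) - frechet_derivative X (at x) (Y x)"

text \<open>The connection is holomorphic on the complement, so its curvature, torsion and the covariant
  derivative of a metric are determined by local holomorphic vector fields.\<close>

definition flat_connection ::
  "(complex^'n) set set \<Rightarrow> ((complex^'n) set \<Rightarrow> complex^'n \<Rightarrow> complex) \<Rightarrow>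
   ((complex^'n) set \<Rightarrow> complex^'n^'n) \<Rightarrow> bool" where
  "flat_connection \<H> h A \<longleftrightarrow>
     (\<forall>U X Y Z. open U \<longrightarrow> U \<subseteq> complement \<H> \<longrightarrow>
        holomorphic_field_on U X \<longrightarrow> holomorphic_field_on U Y \<longrightarrow> holomorphic_field_on U Z \<longrightarrow>
        (\<forall>x\<in>U. nabla \<H> h A X (nabla \<H> h A Y Z) x - nabla \<H> h A Y (nabla \<H> h A X Z) x
                 - nabla \<H> h A (lie_bracket X Y) Z x = 0))"

definition torsion_free ::
  "(complex^'n) set set \<Rightarrow> ((complex^'n) set \<Rightarrow> complex^'n \<Rightarrow> complex) \<Rightarrow>
   ((complex^'n) set \<Rightarrow> complex^'n^'n) \<Rightarrow> bool" where
  "torsion_free \<H> h A \<longleftrightarrow>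
     (\<forall>U X Y. open U \<longrightarrow> U \<subseteq> complement \<H> \<longrightarrow>
        holomorphic_field_on U X \<longrightarrow> holomorphic_field_on U Y \<longrightarrow>
        (\<forall>x\<in>U. nabla \<H> h A X Y x - nabla \<H> h A Y X x - lie_bracket X Y x = 0))"

definition weight ::
  "(complex^'n) set set \<Rightarrow> ((complex^'n) set \<Rightarrow> complex^'n^'n) \<Rightarrow> (complex^'n) set \<Rightarrow> complex" where
  "weight \<H> A L = (\<Sum>H\<in>localization \<H> L. trace (A H)) / of_nat (codim L)"

section \<open>Hermitian and Kaehler metrics\<close>

text \<open>\<open>Ck_on k S f\<close>: on the open set \<open>S\<close> of a finite-dimensional space, \<open>f\<close> is \<open>k\<close> times
  continuously differentiable in the real sense.\<close>

primrec Ck_on :: "nat \<Rightarrow> 'a::euclidean_space set \<Rightarrow> ('a \<Rightarrow> 'b::real_normed_vector) \<Rightarrow> bool" where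
  "Ck_on 0 S f \<longleftrightarrow> continuous_on S f"
| "Ck_on (Suc k) S f \<longleftrightarrow>
     (\<forall>x\<in>S. f differentiable (at x)) \<and> (\<forall>v. Ck_on k S (\<lambda>x. frechet_derivative f (at x) v))"

definition smooth_on :: "'a::euclidean_space set \<Rightarrow> ('a \<Rightarrow> 'b::real_normed_vector) \<Rightarrow> bool" where
  "smooth_on S f \<longleftrightarrow> (\<forall>k. Ck_on k S f)"

definition hermitian_inner_product :: "(complex^'n \<Rightarrow> complex^'n \<Rightarrow> complex) \<Rightarrow> bool" where
  "hermitian_inner_product b \<longleftrightarrow>
     (\<forall>v. Vector_Spaces.linear (*s) (*) (\<lambda>u. b u v)) \<and>
     (\<forall>u v. b v u = cnj (b u v)) \<and>
     (\<forall>u. u \<noteq> 0 \<longrightarrow> 0 < Re (b u u))"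

definition hermitian_metric_on ::
  "(complex^'n) set \<Rightarrow> (complex^'n \<Rightarrow> complex^'n \<Rightarrow> complex^'n \<Rightarrow> complex) \<Rightarrow> bool" where
  "hermitian_metric_on M g \<longleftrightarrow>
     (\<forall>x\<in>M. hermitian_inner_product (g x)) \<and> (\<forall>u v. smooth_on M (\<lambda>x. g x u v))"

text \<open>The Riemannian metric underlying \<open>g\<close> is \<open>Re g\<close>, and its Kaehler form is
  \<open>\<omega>(u,v) = Re g(\<i>u,v) = - Im g(u,v)\<close>.\<close>

definition kaehler_form ::
  "(complex^'n \<Rightarrow> complex^'n \<Rightarrow> complex^'n \<Rightarrow> complex) \<Rightarrow> complex^'n \<Rightarrow> complex^'n \<Rightarrow> complex^'n \<Rightarrow> real"
  where "kaehler_form g x u v = - Im (g x u v)"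

text \<open>The last clause is \<open>d\<omega> = 0\<close>, evaluated on constant vector fields.\<close>

definition kaehler_metric_on ::
  "(complex^'n) set \<Rightarrow> (complex^'n \<Rightarrow> complex^'n \<Rightarrow> complex^'n \<Rightarrow> complex) \<Rightarrow> bool" where
  "kaehler_metric_on M g \<longleftrightarrow> hermitian_metric_on M g \<and>
     (\<forall>x\<in>M. \<forall>u v w.
        frechet_derivative (\<lambda>y. kaehler_form g y v w) (at x) u +
        frechet_derivative (\<lambda>y. kaehler_form g y w u) (at x) v +
        frechet_derivative (\<lambda>y. kaehler_form g y u v) (at x) w = 0)"

text \<open>\<open>\<nabla>g = 0\<close>: \<open>d(g(X,Y))(v) = g(\<nabla>\<^sub>v X, Y) + g(X, \<nabla>\<^sub>v Y)\<close>, with \<open>v\<close> viewed as a constant field.\<close>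

definition parallel_metric ::
  "(complex^'n) set set \<Rightarrow> ((complex^'n) set \<Rightarrow> complex^'n \<Rightarrow> complex) \<Rightarrow>
   ((complex^'n) set \<Rightarrow> complex^'n^'n) \<Rightarrow>
   (complex^'n \<Rightarrow> complex^'n \<Rightarrow> complex^'n \<Rightarrow> complex) \<Rightarrow> bool" where
  "parallel_metric \<H> h A g \<longleftrightarrow>
     (\<forall>U X Y. open U \<longrightarrow> U \<subseteq> complement \<H> \<longrightarrow>
        holomorphic_field_on U X \<longrightarrow> holomorphic_field_on U Y \<longrightarrow>
        (\<forall>x\<in>U. \<forall>v. frechet_derivative (\<lambda>y. g y (X y) (Y y)) (at x) v =
           g x (nabla \<H> h A (\<lambda>_. v) X x) (Y x) + g x (X x) (nabla \<H> h A (\<lambda>_. v) Y x)))"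

definition unitary_connection ::
  "(complex^'n) set set \<Rightarrow> ((complex^'n) set \<Rightarrow> complex^'n \<Rightarrow> complex) \<Rightarrow>
   ((complex^'n) set \<Rightarrow> complex^'n^'n) \<Rightarrow> bool" where
  "unitary_connection \<H> h A \<longleftrightarrow>
     (\<exists>g. hermitian_metric_on (complement \<H>) g \<and> parallel_metric \<H> h A g)"

section \<open>Holonomy\<close>

text \<open>Along a piecewise C1 path, a section is parallel if it is continuous and
  \<open>s' = \<Omega>(\<gamma>') s\<close> away from finitely many parameters (the corners of the path).\<close>

definition parallel_along ::
  "(complex^'n) set set \<Rightarrow> ((complex^'n) set \<Rightarrow> complex^'n \<Rightarrow> complex) \<Rightarrow>
   ((complex^'n) set \<Rightarrow> complex^'n^'n) \<Rightarrow> (real \<Rightarrow> complex^'n) \<Rightarrow> (real \<Rightarrow> complex^'n) \<Rightarrow> bool" where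
  "parallel_along \<H> h A \<gamma> s \<longleftrightarrow> continuous_on {0..1} s \<and>
     (\<exists>S. finite S \<and> (\<forall>t\<in>{0..1} - S.
        \<gamma> differentiable (at t) \<and>
        (s has_vector_derivative conn_form \<H> h A (\<gamma> t) (vector_derivative \<gamma> (at t)) (s t)) (at t)))"

text \<open>The holonomies at \<open>p\<close>: the parallel transports along loops in the complement based at \<open>p\<close>.
  For a flat connection this is the image of the fundamental group under the holonomy
  representation.\<close>

definition holonomies ::
  "(complex^'n) set set \<Rightarrow> ((complex^'n) set \<Rightarrow> complex^'n \<Rightarrow> complex) \<Rightarrow>
   ((complex^'n) set \<Rightarrow> complex^'n^'n) \<Rightarrow> complex^'n \<Rightarrow> (complex^'n \<Rightarrow> complex^'n) set" where
  "holonomies \<H> h A p =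
     {T. \<exists>\<gamma>. valid_path \<gamma> \<and> path_image \<gamma> \<subseteq> complement \<H> \<and> pathstart \<gamma> = p \<and> pathfinish \<gamma> = p \<and>
        (\<forall>v. \<exists>s. parallel_along \<H> h A \<gamma> s \<and> s 0 = v \<and> s 1 = T v)}"

definition irreducible_holonomy ::
  "(complex^'n) set set \<Rightarrow> ((complex^'n) set \<Rightarrow> complex^'n \<Rightarrow> complex) \<Rightarrow>
   ((complex^'n) set \<Rightarrow> complex^'n^'n) \<Rightarrow> complex^'n \<Rightarrow> bool" where
  "irreducible_holonomy \<H> h A p \<longleftrightarrow>
     \<not> (\<exists>W. vec.subspace W \<and> W \<noteq> {0} \<and> W \<noteq> UNIV \<and> (\<forall>T\<in>holonomies \<H> h A p. T ` W \<subseteq> W))"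

end

theory Submission
  imports Defs "HOL-Complex_Analysis.Complex_Analysis"
begin

text \<open>Suppose that a non-zero proper subspace \<open>W\<close> of the tangent space at \<open>p\<close> is invariant under all
  holonomies. Parallel transport preserves \<open>g\<close>, so the \<open>g\<close>-orthogonal projection \<open>P\<^sub>0\<close> onto \<open>W\<close> commutes
  with every holonomy and extends, by parallel transport, to a single-valued parallel field of
  endomorphisms \<open>P\<close>. It suffices that \<open>P\<close> is constant in the linear frame: then \<open>P\<^sub>0\<close> commutes with
  all residues \<open>A\<^sub>H\<close>, and a Schur lemma for irreducible arrangements makes \<open>P\<^sub>0\<close> a scalar, which no
  projection onto a non-zero proper subspace is.

  The algebra of the residues. Vanishing torsion means \<open>A\<^sub>H w = h\<^sub>H(w) n\<^sub>H\<close>, with \<open>h\<^sub>H(n\<^sub>H) = tr A\<^sub>H\<close>, and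
  this trace is the weight at \<open>H\<close>, hence not an integer. If an endomorphism \<open>M\<close> commutes with
  all \<open>A\<^sub>H\<close>, then every \<open>h\<^sub>H\<close> is an eigenvector of the transpose of \<open>M\<close>. Two different eigenvalues would
  split the arrangement into two parts with independent spans, so irreducibility leaves one eigenvalue,
  and \<open>M\<close> is scalar because the \<open>h\<^sub>H\<close> span the dual space (\<open>commutant_scalar\<close>). Flatness, contracted with
  the Euler field, says that \<open>A\<^sub>0 = \<Sum> A\<^sub>H\<close> commutes with all \<open>A\<^sub>H\<close>; so \<open>A\<^sub>0\<close> is itself a scalar.

  The constancy of \<open>P\<close>. It is enough to look at a complex line \<open>p + z v\<close> meeting the hyperplanes at distinct
  points \<open>z = t\<^sub>H\<close>. There \<open>P\<close> solves the Fuchsian system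
  \<open>P' = \<Sum> [A\<^sub>H, P] / (z - t\<^sub>H)\<close>. A Gronwall estimate bounds \<open>P\<close> near \<open>t\<^sub>H\<close> by a power of
  \<open>1 / |z - t\<^sub>H|\<close>, so \<open>P\<close> has at worst a pole; the leading coefficient of a pole of order \<open>k\<close> is an
  eigenvector of \<open>ad A\<^sub>H\<close> with eigenvalue \<open>-k\<close>. The eigenvalues of \<open>ad A\<^sub>H\<close> are \<open>0\<close> and \<open>\<plusminus>tr A\<^sub>H\<close>, so there is no
  pole. At infinity the same argument applies with the residue \<open>-ad A\<^sub>0 = 0\<close>. So \<open>P\<close> is bounded and entire,
  hence constant (\<open>nonresonant_fuchsian_constant\<close>), and comparing residues gives \<open>[A\<^sub>H, P\<^sub>0] = 0\<close>
  (\<open>monodromy_commutant_commutes_with_residues\<close>).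

  Parallel transport along the line is built from local holomorphic frames, obtained as power series; every
  transport around a loop in the line is realised by a piecewise smooth loop in the complement and
  is therefore one of the holonomies at \<open>p\<close>.\<close>

(* The infix dollar sign denotes vector components throughout, not power series coefficients. *)
no_notation fps_nth (infixl \<open>$\<close> 75)

section \<open>Linear forms and hyperplane arrangements\<close>

lemma form_add: "Vector_Spaces.linear (*s) (*) f \<Longrightarrow> f (x + y) = f x + f y"
  and form_scale: "Vector_Spaces.linear (*s) (*) f \<Longrightarrow> f (c *s x) = c * f x"
  and form_diff: "Vector_Spaces.linear (*s) (*) f \<Longrightarrow> f (x - y) = f x - f y"
  and form_zero: "Vector_Spaces.linear (*s) (*) f \<Longrightarrow> f 0 = 0"
  for f :: "complex^'n \<Rightarrow> complex"
  by (erule module_hom.add[OF Vector_Spaces.linear.axioms(3)] module_hom.scale[OF Vector_Spaces.linear.axioms(3)]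
        module_hom.diff[OF Vector_Spaces.linear.axioms(3)] module_hom.zero[OF Vector_Spaces.linear.axioms(3)])+

lemma scaleR_vec_eq: "c *\<^sub>R x = of_real c *s x" for x :: "complex^'n"
  unfolding vec_eq_iff vector_scaleR_component vector_smult_component by (simp add: scaleR_conv_of_real)

lemma linear_formI:
  fixes f :: "complex^'n \<Rightarrow> complex"
  assumes "\<And>x y. f (x + y) = f x + f y" "\<And>c x. f (c *s x) = c * f x"
  shows "Vector_Spaces.linear (*s) (*) f"
  using assms by unfold_locales (auto simp: algebra_simps)

lemma form_sum:
  fixes f :: "complex^'n \<Rightarrow> complex"
  assumes "Vector_Spaces.linear (*s) (*) f"
  shows "f (\<Sum>i\<in>I. x i) = (\<Sum>i\<in>I. f (x i))"
  by (induction I rule: infinite_finite_induct) (auto simp: form_add[OF assms] form_zero[OF assms])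

text \<open>A complex vector space is not a finite union of hyperplanes: moving a vector \<open>v\<close> off one more
  hyperplane along \<open>v + c u\<close> excludes only finitely many values of \<open>c\<close>.\<close>

lemma common_nonvanishing_vector:
  fixes F :: "(complex^'n \<Rightarrow> complex) set"
  assumes "finite F" and "\<And>f. f \<in> F \<Longrightarrow> Vector_Spaces.linear (*s) (*) f"
    and "\<And>f. f \<in> F \<Longrightarrow> f \<noteq> (\<lambda>x. 0)"
  shows "\<exists>v. \<forall>f\<in>F. f v \<noteq> 0"
  using assms
proof (induction F rule: finite_induct)
  case empty
  then show ?case by simp
next
  case (insert f F)
  then obtain v where v: "\<forall>k\<in>F. k v \<noteq> 0" by auto
  obtain u where u: "f u \<noteq> 0" using insert.prems(2)[of f] by fastforce
  have lin: "Vector_Spaces.linear (*s) (*) k" if "k \<in> insert f F" for k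
    using insert.prems(1) that by blast
  \<comment> \<open>For each \<open>k\<close> there is at most one scalar \<open>c\<close> with \<open>k (v + c *s u) = 0\<close>.\<close>
  have "infinite (UNIV - (insert (- f v / f u) ((\<lambda>k. - k v / k u) ` F)))"
    using insert.hyps(1) infinite_UNIV_char_0 by (intro Diff_infinite_finite) auto
  then obtain c :: complex where c: "c \<notin> insert (- f v / f u) ((\<lambda>k. - k v / k u) ` F)"
    using infinite_imp_nonempty by blast
  have "k (v + c *s u) \<noteq> 0" if "k \<in> insert f F" for k
  proof
    assume "k (v + c *s u) = 0"
    then have *: "k v + c * k u = 0"
      using lin[OF that] by (simp add: form_add form_scale)
    have "k u \<noteq> 0" using * that v u by auto
    then have "c = - k v / k u" using * by (simp add: field_simps add_eq_0_iff)
    then show False using c that by auto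
  qed
  then show ?case by blast
qed

text \<open>The coefficient \<open>c j\<close> is the residue of the sum at \<open>t j\<close>.\<close>

lemma partial_fractions_zero:
  fixes c t :: "'i \<Rightarrow> complex"
  assumes "finite I" "inj_on t I"
    and zero: "\<And>z. z \<notin> t ` I \<Longrightarrow> (\<Sum>i\<in>I. c i / (z - t i)) = 0" and "j \<in> I"
  shows "c j = 0"
proof -
  have ev: "\<forall>\<^sub>F z in at (t j). z \<notin> t ` I"
    using assms(1) islimpt_finite[of "t ` I" "t j"] by (simp add: islimpt_iff_eventually)
  have "((\<lambda>z. c j + (z - t j) * (\<Sum>i\<in>I-{j}. c i / (z - t i))) \<longlongrightarrow>
      c j + (t j - t j) * (\<Sum>i\<in>I-{j}. c i / (t j - t i))) (at (t j))"
    using assms(2,4) by (intro tendsto_intros) (auto simp: inj_on_def)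
  moreover have "\<forall>\<^sub>F z in at (t j). c j + (z - t j) * (\<Sum>i\<in>I-{j}. c i / (z - t i)) = 0"
    using ev
  proof eventually_elim
    case (elim z)
    have "z - t j \<noteq> 0" using elim assms(4) by auto
    have "0 = (z - t j) * (\<Sum>i\<in>I. c i / (z - t i))" using zero[OF elim] by simp
    also have "\<dots> = (z - t j) * (c j / (z - t j) + (\<Sum>i\<in>I-{j}. c i / (z - t i)))"
      using assms(1,4) by (subst sum.remove[of I j]) auto
    also have "\<dots> = c j + (z - t j) * (\<Sum>i\<in>I-{j}. c i / (z - t i))"
      using \<open>z - t j \<noteq> 0\<close> unfolding distrib_left by simp
    finally show ?case by simp
  qed
  ultimately have "((\<lambda>z. 0::complex) \<longlongrightarrow> c j) (at (t j))"
    using Lim_transform_eventually by fastforce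
  then show ?thesis by (simp add: tendsto_const_iff)
qed

context
  fixes \<H> :: "(complex^'n) set set"
    and h :: "(complex^'n) set \<Rightarrow> complex^'n \<Rightarrow> complex"
  assumes arr: "arrangement \<H> h"
begin

lemma equation_linear: "H \<in> \<H> \<Longrightarrow> Vector_Spaces.linear (*s) (*) (h H)"
  using arr by (auto simp: arrangement_def)

lemma finite_arrangement: "finite \<H>"
  using arr by (auto simp: arrangement_def)

lemma mem_hyperplane: "H \<in> \<H> \<Longrightarrow> x \<in> H \<longleftrightarrow> h H x = 0"
  using arr unfolding arrangement_def by blast

lemma equation_nonzero_ex: "H \<in> \<H> \<Longrightarrow> \<exists>v. h H v \<noteq> 0"
  using arr unfolding arrangement_def by fastforce

lemma mem_complement: "x \<in> complement \<H> \<longleftrightarrow> (\<forall>H\<in>\<H>. h H x \<noteq> 0)"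
  using mem_hyperplane by (auto simp: complement_def)

lemma hyperplane_subset_imp_eq:
  assumes "H \<in> \<H>" "H' \<in> \<H>" "H \<subseteq> H'"
  shows "H = H'"
proof -
  obtain v where v: "h H v \<noteq> 0" using assms equation_nonzero_ex by blast
  have prp: "h H' x = h H x / h H v * h H' v" for x
  proof -
    have "h H (x - (h H x / h H v) *s v) = 0"
      using v by (simp add: form_diff[OF equation_linear[OF assms(1)]] form_scale[OF equation_linear[OF assms(1)]])
    then have "h H' (x - (h H x / h H v) *s v) = 0"
      using assms mem_hyperplane by blast
    then show ?thesis
      by (simp add: form_diff[OF equation_linear[OF assms(2)]] form_scale[OF equation_linear[OF assms(2)]])
  qed
  then have "h H' v \<noteq> 0" using assms equation_nonzero_ex by fastforce
  then have "h H' x = 0 \<longleftrightarrow> h H x = 0" for x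
    using prp[of x] v by simp
  then show ?thesis using assms mem_hyperplane by blast
qed

text \<open>A direction \<open>v\<close> is generic if no equation vanishes on it and if the line through \<open>p\<close> meets no two
  hyperplanes in the same point. Equality of the points for \<open>H\<close> and \<open>H'\<close> is the vanishing of the
  linear form \<open>h H p * h H' u - h H' p * h H u\<close> at \<open>u = v\<close>, and this form is not identically zero because
  distinct hyperplanes have non-proportional equations.\<close>

lemma generic_line:
  assumes p: "p \<in> complement \<H>"
  obtains v t where "\<And>H. H \<in> \<H> \<Longrightarrow> h H v \<noteq> 0" "inj_on t \<H>"
    "\<And>H z. H \<in> \<H> \<Longrightarrow> h H (p + z *s v) = h H v * (z - t H)"
proof -
  define k where "k = (\<lambda>(H, H') u. h H p * h H' u - h H' p * h H u)"
  define Q where "Q = {(H, H'). H \<in> \<H> \<and> H' \<in> \<H> \<and> H \<noteq> H'}"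
  have finQ: "finite Q"
    by (rule finite_subset[of _ "\<H> \<times> \<H>"]) (auto simp: Q_def finite_arrangement)
  have "\<exists>v. \<forall>f\<in>h ` \<H> \<union> k ` Q. f v \<noteq> 0"
  proof (rule common_nonvanishing_vector)
    show "finite (h ` \<H> \<union> k ` Q)" using finQ finite_arrangement by simp
  next
    fix f assume "f \<in> h ` \<H> \<union> k ` Q"
    then show "Vector_Spaces.linear (*s) (*) f"
    proof
      assume "f \<in> k ` Q"
      then obtain H H' where f: "f = k (H, H')" and "H \<in> \<H>" "H' \<in> \<H>" by (auto simp: Q_def)
      note l = equation_linear[OF \<open>H \<in> \<H>\<close>] equation_linear[OF \<open>H' \<in> \<H>\<close>]
      show ?thesis unfolding f k_def prod.case
        by (rule linear_formI)
          (simp_all add: form_add[OF l(1)] form_add[OF l(2)] form_scale[OF l(1)] form_scale[OF l(2)] algebra_simps)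
    qed (auto simp: equation_linear)
  next
    fix f assume "f \<in> h ` \<H> \<union> k ` Q"
    then show "f \<noteq> (\<lambda>x. 0)"
    proof
      assume "f \<in> k ` Q"
      then obtain H H' where f: "f = k (H, H')" and HH: "H \<in> \<H>" "H' \<in> \<H>" "H \<noteq> H'" by (auto simp: Q_def)
      show ?thesis
      proof
        assume "f = (\<lambda>x. 0)"
        then have e: "h H p * h H' u = h H' p * h H u" for u
          unfolding f k_def prod.case by (drule_tac x=u in fun_cong) simp
        have nz: "h H p \<noteq> 0" "h H' p \<noteq> 0" using p HH by (auto simp: mem_complement)
        have "h H' u = 0" if "h H u = 0" for u
          using e[of u] nz that by simp
        then have "H \<subseteq> H'" using HH mem_hyperplane by blast
        then show False using hyperplane_subset_imp_eq HH by blast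
      qed
    qed (use arr in \<open>auto simp: arrangement_def\<close>)
  qed
  then obtain v where v: "\<forall>f\<in>h ` \<H> \<union> k ` Q. f v \<noteq> 0" by blast
  show ?thesis
  proof
    show nz: "h H v \<noteq> 0" if "H \<in> \<H>" for H using v that by auto
    show "h H (p + z *s v) = h H v * (z - (- h H p / h H v))" if "H \<in> \<H>" for H z
      using nz[OF that] by (simp add: form_add[OF equation_linear[OF that]] form_scale[OF equation_linear[OF that]] distrib_left)
    show "inj_on (\<lambda>H. - h H p / h H v) \<H>"
    proof (rule inj_onI, rule ccontr)
      fix H H' assume HH: "H \<in> \<H>" "H' \<in> \<H>" "- h H p / h H v = - h H' p / h H' v" "H \<noteq> H'"
      then have "k (H, H') v \<noteq> 0" using v by (auto simp: Q_def)
      moreover have "h H p * h H' v = h H' p * h H v"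
        using HH(3) nz[OF HH(1)] nz[OF HH(2)] by (simp add: frac_eq_eq)
      ultimately show False by (simp add: k_def)
    qed
  qed
qed

lemma complement_nonempty: "\<exists>p. p \<in> complement \<H>"
proof -
  have "\<exists>v. \<forall>f\<in>h ` \<H>. f v \<noteq> 0"
    using arr by (intro common_nonvanishing_vector) (auto simp: arrangement_def)
  then show ?thesis by (auto simp: mem_complement)
qed

text \<open>On a generic line the functions \<open>1 / h H\<close> become simple fractions with distinct poles.\<close>

lemma log_poles_independent:
  assumes zero: "\<And>x. x \<in> complement \<H> \<Longrightarrow> (\<Sum>H\<in>\<H>. c H / h H x) = 0" and "H \<in> \<H>"
  shows "c H = 0"
proof -
  obtain p where p: "p \<in> complement \<H>" using complement_nonempty by blast
  obtain v t where v: "\<And>H. H \<in> \<H> \<Longrightarrow> h H v \<noteq> 0" and inj: "inj_on t \<H>"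
    and line: "\<And>H z. H \<in> \<H> \<Longrightarrow> h H (p + z *s v) = h H v * (z - t H)"
    using generic_line[OF p] by blast
  have "c H / h H v = 0"
  proof (rule partial_fractions_zero[OF finite_arrangement inj _ assms(2)])
    fix z assume z: "z \<notin> t ` \<H>"
    have "p + z *s v \<in> complement \<H>"
      using z v by (auto simp: mem_complement line)
    then have "(\<Sum>H\<in>\<H>. c H / h H (p + z *s v)) = 0" by (rule zero)
    moreover have "(\<Sum>H\<in>\<H>. c H / h H (p + z *s v)) = (\<Sum>H\<in>\<H>. c H / h H v / (z - t H))"
      by (intro sum.cong) (auto simp: line)
    ultimately show "(\<Sum>H\<in>\<H>. c H / h H v / (z - t H)) = 0" by simp
  qed
  then show ?thesis using v[OF assms(2)] by simp
qed

lemma codim_hyperplane: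
  assumes "H \<in> \<H>"
  shows "codim H = 1"
proof -
  note l = equation_linear[OF assms]
  obtain v where v: "h H v \<noteq> 0" using assms equation_nonzero_ex by blast
  have sub: "vec.subspace H"
    unfolding vec.subspace_def using mem_hyperplane[OF assms]
    by (auto simp: form_add[OF l] form_scale[OF l] form_zero[OF l])
  have "x \<in> vec.span (insert v H)" for x
  proof -
    have "h H (x - (h H x / h H v) *s v) = 0"
      using v by (simp add: form_diff[OF l] form_scale[OF l])
    then have "x - (h H x / h H v) *s v \<in> H" using mem_hyperplane[OF assms] by blast
    then have "(x - (h H x / h H v) *s v) + (h H x / h H v) *s v \<in> vec.span (insert v H)"
      by (intro vec.span_add vec.span_scale vec.span_base) auto
    then show ?thesis by simp
  qed
  then have "vec.span (insert v H) = UNIV" by blast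
  then have "vec.dim (insert v H) = CARD('n)"
    by (metis vec.dim_span vec_dim_card)
  moreover have "v \<notin> vec.span H"
    using sub v mem_hyperplane[OF assms] by (simp add: vec.span_eq_iff[THEN iffD2])
  ultimately show ?thesis by (simp add: codim_def vec.dim_insert)
qed

text \<open>A hyperplane contains no other hyperplane of the arrangement, and one equation cannot be split in two;
  so the hypothesis on weights applies to each member of the arrangement.\<close>

lemma hyperplane_irreducible_intersection:
  assumes H: "H \<in> \<H>"
  shows "H \<in> irreducible_intersections \<H> h" and "localization \<H> H = {H}"
proof -
  show loc: "localization \<H> H = {H}"
  proof (intro equalityI subsetI)
    fix K assume "K \<in> localization \<H> H"
    then have "H = K" using hyperplane_subset_imp_eq[OF H, of K] by (simp add: localization_def)
    then show "K \<in> {H}" by simp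
  next
    fix K assume "K \<in> {H}"
    then show "K \<in> localization \<H> H" using H unfolding localization_def by blast
  qed
  obtain v where v: "h H v \<noteq> 0" using H equation_nonzero_ex by blast
  have "irreducible_arrangement h {H}"
    unfolding irreducible_arrangement_def reducible_arrangement_def
  proof (rule notI, elim exE conjE)
    fix B1 B2 assume B: "B1 \<noteq> {}" "B2 \<noteq> {}" "{H} = B1 \<union> B2"
      and ds: "is_direct_sum (equation_span h {H}) (equation_span h B1) (equation_span h B2)"
    have "B1 \<subseteq> {H}" "B2 \<subseteq> {H}" unfolding B(3) by (rule Un_upper1, rule Un_upper2)
    then have "B1 = {H}" "B2 = {H}" using B(1,2) by (simp_all add: subset_singleton_iff)
    moreover have "h H \<in> equation_span h {H}"
      by (auto simp: equation_span_def intro!: exI[of _ "\<lambda>_. 1"])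
    ultimately have "h H \<in> {\<lambda>x. 0}" using ds unfolding is_direct_sum_def by (metis IntI)
    then show False using v by simp
  qed
  moreover have "H \<in> intersection_poset \<H>"
    using H by (auto simp: intersection_poset_def intro!: exI[of _ "{H}"])
  moreover have "H \<noteq> UNIV" using v mem_hyperplane[OF H] by blast
  ultimately show "H \<in> irreducible_intersections \<H> h"
    by (simp add: irreducible_intersections_def loc)
qed

lemma weight_hyperplane: "H \<in> \<H> \<Longrightarrow> weight \<H> A H = trace (A H)"
  by (simp add: weight_def hyperplane_irreducible_intersection codim_hyperplane)

lemma equation_bounded_linear: "H \<in> \<H> \<Longrightarrow> bounded_linear (h H)"
proof (subst linear_conv_bounded_linear[symmetric], rule Real_Vector_Spaces.linearI)
  fix x y c assume H: "H \<in> \<H>"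
  show "h H (x + y) = h H x + h H y" by (rule form_add[OF equation_linear[OF H]])
  then show "h H (c *\<^sub>R x) = c *\<^sub>R h H x"
    by (simp add: scaleR_vec_eq form_scale[OF equation_linear[OF H]] scaleR_conv_of_real)
qed

lemma open_complement: "open (complement \<H>)"
proof -
  have "complement \<H> = (\<Inter>H\<in>\<H>. {x. h H x \<noteq> 0})" by (auto simp: mem_complement)
  moreover have "open {x. h H x \<noteq> 0}" if "H \<in> \<H>" for H
    using equation_bounded_linear[OF that]
    by (intro open_Collect_neq continuous_intros linear_continuous_on)
  ultimately show ?thesis using finite_arrangement by auto
qed

section \<open>Residues of a flat torsion-free connection\<close>

lemma const_holomorphic_field: "holomorphic_field_on U (\<lambda>_. c)"
  unfolding holomorphic_field_on_def
  by (auto intro!: exI[of _ "\<lambda>_. 0"] vec.module_hom_zero simp: vec.linear_0)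

text \<open>Evaluated on constant fields, the torsion is a sum of terms with denominators \<open>h H\<close>, which must
  vanish separately.\<close>

lemma torsion_free_rank_one:
  assumes tf: "torsion_free \<H> h A" and H: "H \<in> \<H>"
  shows "h H v *s (A H *v w) = h H w *s (A H *v v)"
proof -
  have "(\<Sum>H\<in>\<H>. (h H v * (A H *v w) $ i - h H w * (A H *v v) $ i) / h H x) = 0" if "x \<in> complement \<H>" for x i
  proof -
    have "nabla \<H> h A (\<lambda>_. v) (\<lambda>_. w) x - nabla \<H> h A (\<lambda>_. w) (\<lambda>_. v) x - lie_bracket (\<lambda>_. v) (\<lambda>_. w) x = 0"
      using tf that open_complement const_holomorphic_field unfolding torsion_free_def by blast
    then have "conn_form \<H> h A x v w - conn_form \<H> h A x w v = 0"
      by (simp add: nabla_def lie_bracket_def frechet_derivative_const)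
    then have "(conn_form \<H> h A x v w - conn_form \<H> h A x w v) $ i = 0" by simp
    then show ?thesis
      by (simp add: conn_form_def sum_subtractf diff_divide_distrib)
  qed
  from log_poles_independent[OF this H]
  show ?thesis by (auto simp: vec_eq_iff)
qed

lemma conn_form_has_derivative:
  assumes "x \<in> complement \<H>"
  shows "((\<lambda>y. conn_form \<H> h A y w z) has_derivative
    (\<lambda>d. \<Sum>H\<in>\<H>. (- (h H w * h H d) / (h H x)\<^sup>2) *s (A H *v z))) (at x)"
  unfolding conn_form_def
proof (rule has_derivative_sum)
  fix H assume H: "H \<in> \<H>"
  note b = equation_bounded_linear[OF H]
  have nz: "h H x \<noteq> 0" using assms H by (auto simp: mem_complement)
  have "((\<lambda>y. h H w / h H y) has_derivative (\<lambda>d. - (h H w * h H d) / (h H x)\<^sup>2)) (at x)"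
    by (rule derivative_eq_intros bounded_linear_imp_has_derivative[OF b] nz refl)+
      (auto simp: field_simps power2_eq_square nz)
  moreover have "bounded_linear (\<lambda>c. c *s (A H *v z))"
    by (subst linear_conv_bounded_linear[symmetric], rule Real_Vector_Spaces.linearI)
      (simp_all add: vec_eq_iff algebra_simps)
  ultimately show "((\<lambda>y. (h H w / h H y) *s (A H *v z)) has_derivative
      (\<lambda>d. (- (h H w * h H d) / (h H x)\<^sup>2) *s (A H *v z))) (at x)"
    by (rule bounded_linear.has_derivative[rotated])
qed

text \<open>For constant fields the second derivatives in the curvature cancel by symmetry, so flatness says that
  \<open>\<Omega>(u)\<close> and \<open>\<Omega>(w)\<close> commute. At \<open>u = x\<close>, the Euler field, \<open>\<Omega>(u)\<close> is the sum of all residues; then the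
  residues of \<open>\<Omega>(w)\<close> are compared.\<close>

lemma flat_residue_commutes:
  assumes flat: "flat_connection \<H> h A" and H: "H \<in> \<H>"
  shows "(\<Sum>K\<in>\<H>. A K) ** A H = A H ** (\<Sum>K\<in>\<H>. A K)"
proof -
  define A0 where "A0 = (\<Sum>K\<in>\<H>. A K)"
  have A0: "A0 *v z = (\<Sum>K\<in>\<H>. A K *v z)" for z
    unfolding A0_def by (induction \<H> rule: infinite_finite_induct) (auto simp: matrix_vector_mult_add_rdistrib)
  have curv: "conn_form \<H> h A x u (conn_form \<H> h A x w z) = conn_form \<H> h A x w (conn_form \<H> h A x u z)"
    if x: "x \<in> complement \<H>" for x u w z
  proof -
    have n1: "nabla \<H> h A (\<lambda>_. w) (\<lambda>_. z) = (\<lambda>y. - conn_form \<H> h A y w z)" for w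
      by (simp add: nabla_def fun_eq_iff frechet_derivative_const)
    have fd: "frechet_derivative (\<lambda>y. - conn_form \<H> h A y w z) (at x) =
       (\<lambda>d. - (\<Sum>H\<in>\<H>. (- (h H w * h H d) / (h H x)\<^sup>2) *s (A H *v z)))" for w
      by (rule frechet_derivative_at[symmetric]) (intro derivative_intros conn_form_has_derivative x)
    have neg: "conn_form \<H> h A x u (- y) = - conn_form \<H> h A x u y" for u y
      by (simp add: conn_form_def sum_negf[symmetric] vec.neg vector_smult_rneg)
    have lb: "lie_bracket (\<lambda>_. u) (\<lambda>_. w) = (\<lambda>x. 0)"
      by (simp add: lie_bracket_def frechet_derivative_const fun_eq_iff)
    have c0: "conn_form \<H> h A x 0 z = 0"
    proof -
      have "h H 0 = 0" if "H \<in> \<H>" for H using form_zero[OF equation_linear[OF that]] .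
      then show ?thesis by (simp add: conn_form_def)
    qed
    have "nabla \<H> h A (\<lambda>_. u) (nabla \<H> h A (\<lambda>_. w) (\<lambda>_. z)) x
        - nabla \<H> h A (\<lambda>_. w) (nabla \<H> h A (\<lambda>_. u) (\<lambda>_. z)) x
        - nabla \<H> h A (lie_bracket (\<lambda>_. u) (\<lambda>_. w)) (\<lambda>_. z) x = 0"
      using flat x open_complement const_holomorphic_field unfolding flat_connection_def by blast
    then show ?thesis
      unfolding n1 lb by (simp add: nabla_def fd neg mult.commute frechet_derivative_const c0)
  qed
  have "(A0 *v (A H *v z)) = A H *v (A0 *v z)" for z
  proof -
    obtain w where w: "h H w \<noteq> 0" using H equation_nonzero_ex by blast
    have "(\<Sum>K\<in>\<H>. (h K w * (A0 *v (A K *v z) - A K *v (A0 *v z)) $ i) / h K x) = 0"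
      if x: "x \<in> complement \<H>" for x i
    proof -
      have e: "conn_form \<H> h A x x y = A0 *v y" for y
        unfolding conn_form_def A0 by (intro sum.cong) (use x in \<open>auto simp: mem_complement\<close>)
      have "A0 *v conn_form \<H> h A x w z - conn_form \<H> h A x w (A0 *v z) = 0"
        using curv[OF x, of x w z] by (simp add: e)
      moreover have "A0 *v conn_form \<H> h A x w z = (\<Sum>K\<in>\<H>. (h K w / h K x) *s (A0 *v (A K *v z)))"
        by (simp add: conn_form_def vec.linear_sum[OF matrix_vector_mul_linear_gen] vector_scalar_commute)
      ultimately have "(\<Sum>K\<in>\<H>. (h K w / h K x) *s (A0 *v (A K *v z) - A K *v (A0 *v z))) $ i = 0"
        by (simp add: conn_form_def sum_subtractf vector_ssub_ldistrib del: sum_component)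
      then show ?thesis by (simp add: diff_divide_distrib right_diff_distrib)
    qed
    from log_poles_independent[OF this H] w show ?thesis by (auto simp: vec_eq_iff)
  qed
  then show ?thesis
    unfolding A0_def[symmetric] by (simp add: matrix_eq matrix_vector_mul_assoc[symmetric])
qed

text \<open>Each equation is an eigenvector of the transpose of \<open>M\<close>. The equations with one chosen
  eigenvalue and the remaining ones span independent spaces, because a polynomial in \<open>M\<close> annihilates the latter and
  acts invertibly on the former. Irreducibility therefore allows only one eigenvalue.\<close>

lemma eigenforms_common_eigenvalue:
  assumes ess: "essential \<H>" and irr: "irreducible_arrangement h \<H>"
    and M: "\<And>H x. H \<in> \<H> \<Longrightarrow> h H (M *v x) = lam H * h H x"
  shows "\<exists>c. \<forall>x. M *v x = c *s x"
proof -
  have const: "lam H = lam K" if HK: "H \<in> \<H>" "K \<in> \<H>" for H K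
  proof (rule ccontr)
    assume ne: "lam H \<noteq> lam K"
    define B1 B2 where "B1 = {J\<in>\<H>. lam J = lam H}" and "B2 = {J\<in>\<H>. lam J \<noteq> lam H}"
    have BU: "B1 \<union> B2 = \<H>" "B1 \<inter> B2 = {}" "finite B1" "finite B2"
      using finite_arrangement by (auto simp: B1_def B2_def)
    \<comment> \<open>\<open>N\<close> stands for the product of the factors \<open>M - \<mu>\<close> over \<open>\<mu> \<in> E\<close>.\<close>
    have poly: "\<exists>N. \<forall>J\<in>\<H>. \<forall>x. h J (N x) = (\<Prod>\<mu>\<in>E. lam J - \<mu>) * h J x" if "finite E" for E
      using that
    proof induction
      case empty
      show ?case by (auto intro!: exI[of _ "\<lambda>x. x"])
    next
      case (insert \<mu> E)
      then obtain N where N: "\<forall>J\<in>\<H>. \<forall>x. h J (N x) = (\<Prod>\<mu>\<in>E. lam J - \<mu>) * h J x" by blast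
      have "h J (N (M *v x - \<mu> *s x)) = (\<Prod>\<mu>\<in>insert \<mu> E. lam J - \<mu>) * h J x" if "J \<in> \<H>" for J x
        using that insert.hyps N M
        by (simp add: form_diff[OF equation_linear] form_scale[OF equation_linear] algebra_simps)
      then show ?case by (intro exI[of _ "\<lambda>x. N (M *v x - \<mu> *s x)"]) blast
    qed
    obtain N where N: "\<And>J x. J \<in> \<H> \<Longrightarrow> h J (N x) = (\<Prod>\<mu>\<in>lam ` B2. lam J - \<mu>) * h J x"
      using poly[of "lam ` B2"] BU(4) by blast
    define k where "k = (\<Prod>\<mu>\<in>lam ` B2. lam H - \<mu>)"
    have k: "k \<noteq> 0" using BU(4) by (auto simp: k_def B2_def)
    have "is_direct_sum (equation_span h \<H>) (equation_span h B1) (equation_span h B2)"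
      unfolding is_direct_sum_def
    proof
      show "equation_span h \<H> = {\<lambda>x. f x + g x |f g. f \<in> equation_span h B1 \<and> g \<in> equation_span h B2}"
      proof (intro equalityI subsetI)
        fix f assume "f \<in> equation_span h \<H>"
        then obtain c where c: "f = (\<lambda>x. \<Sum>H\<in>\<H>. c H * h H x)" by (auto simp: equation_span_def)
        have "f = (\<lambda>x. (\<Sum>H\<in>B1. c H * h H x) + (\<Sum>H\<in>B2. c H * h H x))"
          unfolding c BU(1)[symmetric] using BU(2-4) by (simp add: sum.union_disjoint)
        moreover have "(\<lambda>x. \<Sum>H\<in>B. c H * h H x) \<in> equation_span h B" for B
          unfolding equation_span_def by blast
        ultimately show "f \<in> {\<lambda>x. f x + g x |f g. f \<in> equation_span h B1 \<and> g \<in> equation_span h B2}"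
          unfolding mem_Collect_eq by (intro exI conjI)
      next
        fix f assume "f \<in> {\<lambda>x. f x + g x |f g. f \<in> equation_span h B1 \<and> g \<in> equation_span h B2}"
        then obtain c d where "f = (\<lambda>x. (\<Sum>H\<in>B1. c H * h H x) + (\<Sum>H\<in>B2. d H * h H x))"
          unfolding equation_span_def by blast
        also have "\<dots> = (\<lambda>x. (\<Sum>H\<in>\<H>. (if H \<in> B1 then c H else d H) * h H x))"
        proof
          fix x
          have "(\<Sum>H\<in>\<H>. (if H \<in> B1 then c H else d H) * h H x) =
             (\<Sum>H\<in>B1. (if H \<in> B1 then c H else d H) * h H x) + (\<Sum>H\<in>B2. (if H \<in> B1 then c H else d H) * h H x)"
            unfolding BU(1)[symmetric] using BU by (intro sum.union_disjoint) auto
          also have "(\<Sum>H\<in>B2. (if H \<in> B1 then c H else d H) * h H x) = (\<Sum>H\<in>B2. d H * h H x)"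
            using BU(2) by (intro sum.cong) auto
          finally show "(\<Sum>H\<in>B1. c H * h H x) + (\<Sum>H\<in>B2. d H * h H x) =
             (\<Sum>H\<in>\<H>. (if H \<in> B1 then c H else d H) * h H x)" by simp
        qed
        finally show "f \<in> equation_span h \<H>" unfolding equation_span_def by (intro CollectI exI)
      qed
      show "equation_span h B1 \<inter> equation_span h B2 = {\<lambda>x. 0}"
      proof (intro equalityI subsetI)
        fix f assume "f \<in> equation_span h B1 \<inter> equation_span h B2"
        then obtain c d where c: "f = (\<lambda>x. \<Sum>J\<in>B1. c J * h J x)" and d: "f = (\<lambda>x. \<Sum>J\<in>B2. d J * h J x)"
          unfolding equation_span_def by blast
        have "k * f x = 0" for x
        proof -
          have "f (N x) = (\<Sum>J\<in>B1. c J * (k * h J x))"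
            unfolding c by (intro sum.cong) (auto simp: N B1_def k_def)
          also have "\<dots> = k * f x" unfolding c by (simp add: sum_distrib_left mult_ac)
          finally have "k * f x = f (N x)" by simp
          also have "\<dots> = (\<Sum>J\<in>B2. d J * ((\<Prod>\<mu>\<in>lam ` B2. lam J - \<mu>) * h J x))"
            unfolding d by (intro sum.cong) (auto simp: N B2_def)
          also have "\<dots> = 0" using BU(4) by (intro sum.neutral) auto
          finally show ?thesis .
        qed
        then show "f \<in> {\<lambda>x. 0}" using k by auto
      next
        fix f :: "complex^'n \<Rightarrow> complex" assume "f \<in> {\<lambda>x. 0}"
        then show "f \<in> equation_span h B1 \<inter> equation_span h B2"
          by (auto simp: equation_span_def intro!: exI[of _ "\<lambda>_. 0"])
      qed
    qed
    moreover have "B1 \<noteq> {}" "B2 \<noteq> {}" using HK ne by (auto simp: B1_def B2_def)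
    ultimately show False
      using irr BU(1) unfolding irreducible_arrangement_def reducible_arrangement_def by blast
  qed
  obtain c where c: "\<forall>H\<in>\<H>. lam H = c" using const by (cases "\<H> = {}") blast+
  have "M *v x = c *s x" for x
  proof -
    have "h H (M *v x - c *s x) = 0" if "H \<in> \<H>" for H
      using that c M by (simp add: form_diff[OF equation_linear] form_scale[OF equation_linear])
    then have "M *v x - c *s x \<in> \<Inter>\<H>" using mem_hyperplane by auto
    then show ?thesis using ess unfolding essential_def by (metis eq_iff_diff_eq_0 singletonD)
  qed
  then show ?thesis by blast
qed

text \<open>Schur's lemma for an irreducible essential arrangement.\<close>

lemma commutant_scalar:
  assumes ess: "essential \<H>" and irr: "irreducible_arrangement h \<H>"
    and n: "\<And>H w. H \<in> \<H> \<Longrightarrow> A H *v w = h H w *s n H" and n0: "\<And>H. H \<in> \<H> \<Longrightarrow> h H (n H) \<noteq> 0"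
    and comm: "\<And>H. H \<in> \<H> \<Longrightarrow> M ** A H = A H ** M"
  shows "\<exists>c. \<forall>x. M *v x = c *s x"
proof (rule eigenforms_common_eigenvalue[OF ess irr])
  fix H x assume H: "H \<in> \<H>"
  have *: "h H x *s (M *v n H) = h H (M *v x) *s n H" for x
  proof -
    have "M *v (A H *v x) = A H *v (M *v x)"
      using comm[OF H] by (simp add: matrix_vector_mul_assoc)
    then show ?thesis by (simp add: n[OF H] vector_scalar_commute)
  qed
  have "h H (h H (M *v x) *s n H) = h H (h H x *s (M *v n H))" using * by simp
  then show "h H (M *v x) = (h H (M *v n H) / h H (n H)) * h H x"
    using n0[OF H] by (simp add: form_scale[OF equation_linear[OF H]] field_simps)
qed

text \<open>The symmetry of \<open>torsion_free_rank_one\<close> exhibits \<open>A H\<close> as \<open>w \<mapsto> h H w *s n H\<close>, where \<open>n H\<close> is the image of a vector on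
  which \<open>h H\<close> is \<open>1\<close>.\<close>

lemma residue_rank_one:
  assumes "torsion_free \<H> h A"
  obtains n where "\<And>H w. H \<in> \<H> \<Longrightarrow> A H *v w = h H w *s n H"
    "\<And>H. H \<in> \<H> \<Longrightarrow> h H (n H) = trace (A H)"
proof -
  have "\<exists>n. (\<forall>w. A H *v w = h H w *s n) \<and> h H n = trace (A H)" if H: "H \<in> \<H>" for H
  proof -
    obtain v where v: "h H v \<noteq> 0" using H equation_nonzero_ex by blast
    define n where "n = (1 / h H v) *s (A H *v v)"
    have n: "A H *v w = h H w *s n" for w
    proof -
      have "h H v *s (A H *v w) = h H w *s (A H *v v)" by (rule torsion_free_rank_one[OF assms H])
      then have "(1 / h H v) *s (h H v *s (A H *v w)) = (1 / h H v) *s (h H w *s (A H *v v))" by simp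
      then show ?thesis using v by (simp add: n_def vector_smult_assoc mult.commute)
    qed
    have "trace (A H) = (\<Sum>i\<in>UNIV. (A H *v axis i 1) $ i)"
      by (simp add: trace_def matrix_vector_mult_def axis_def if_distrib[of "\<lambda>x. _ * x"] cong: if_cong)
    also have "\<dots> = h H (\<Sum>i\<in>UNIV. n $ i *s axis i 1)"
      by (simp add: n form_sum[OF equation_linear[OF H]] form_scale[OF equation_linear[OF H]] mult.commute)
    also have "(\<Sum>i\<in>UNIV. n $ i *s axis i 1) = n" by (rule basis_expansion)
    finally show ?thesis using n by metis
  qed
  then show ?thesis using that by metis
qed

end

section \<open>Non-resonant Fuchsian systems\<close>

definition vec_deriv :: "(complex \<Rightarrow> complex^'m) \<Rightarrow> complex^'m \<Rightarrow> complex \<Rightarrow> bool" where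
  "vec_deriv y y' z \<longleftrightarrow> (\<forall>i. ((\<lambda>w. y w $ i) has_field_derivative y' $ i) (at z))"

lemma norm_smult_vec: "norm (c *s x) = norm c * norm x" for x :: "complex^'m"
  by (simp add: norm_vec_def L2_set_right_distrib norm_mult)

lemma bounded_linear_smult_left: "bounded_linear (\<lambda>c. c *s x)" for x :: "complex^'m"
  by (rule bounded_linear_intro[of _ "norm x"])
    (simp_all add: norm_smult_vec vec_eq_iff algebra_simps)

lemma vec_linear_bounded_linear:
  fixes L :: "complex^'m \<Rightarrow> complex^'k"
  assumes "Vector_Spaces.linear (*s) (*s) L"
  shows "bounded_linear L"
proof (rule linear_conv_bounded_linear[THEN iffD1], rule Real_Vector_Spaces.linearI)
  show "L (x + y) = L x + L y" for x y by (rule vec.linear_add[OF assms])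
  show "L (c *\<^sub>R x) = c *\<^sub>R L x" for c x unfolding scaleR_vec_eq by (rule vec.linear_scale[OF assms])
qed

lemma has_derivative_componentI:
  fixes f :: "'a::real_normed_vector \<Rightarrow> complex^'m"
  assumes "\<And>i. ((\<lambda>x. f x $ i) has_derivative (\<lambda>d. f' d $ i)) (at a within S)"
  shows "(f has_derivative f') (at a within S)"
proof (rule has_derivative_componentwise_within[THEN iffD2], rule ballI)
  fix b :: "complex^'m" assume "b \<in> Basis"
  then obtain i c where b: "b = axis i c" unfolding Basis_vec_def by blast
  show "((\<lambda>x. f x \<bullet> b) has_derivative (\<lambda>x. f' x \<bullet> b)) (at a within S)"
    unfolding b inner_axis by (rule has_derivative_inner_left[OF assms])
qed

lemma vec_deriv_has_derivative:
  "vec_deriv y y' z \<Longrightarrow> (y has_derivative (\<lambda>d. d *s y')) (at z)"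
  by (rule has_derivative_componentI)
    (simp add: vec_deriv_def has_field_derivative_def mult_commute_abs)

lemma vec_deriv_holomorphic:
  fixes f :: "complex \<Rightarrow> complex^'m"
  assumes "\<And>z. z \<in> S \<Longrightarrow> vec_deriv f (f' z) z"
  shows "(\<lambda>z. f z $ i) holomorphic_on S"
  unfolding holomorphic_on_def field_differentiable_def
  using assms has_field_derivative_at_within unfolding vec_deriv_def by blast

lemma vec_deriv_along_line:
  assumes "vec_deriv y y' (a + of_real t * b)"
  shows "((\<lambda>t. y (a + of_real t * b)) has_vector_derivative b *s y') (at t)"
proof -
  have "((\<lambda>t. a + of_real t * b) has_derivative (\<lambda>d. of_real d * b)) (at t)"
    by (auto intro!: derivative_eq_intros simp: bounded_linear.has_derivative[OF bounded_linear_of_real])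
  from has_derivative_compose[OF this vec_deriv_has_derivative[OF assms]]
  show ?thesis by (simp add: has_vector_derivative_def scaleR_vec_eq vector_smult_assoc)
qed

text \<open>Gronwall's inequality along rays: \<open>|y'| \<le> K |y| / s\<close> at distance \<open>s\<close> from the origin makes
  \<open>(s ^ N |y|)\<^sup>2\<close> non-decreasing in \<open>s\<close> when \<open>K \<le> N\<close>, and it is bounded on the outer circle by compactness.\<close>

lemma fuchsian_growth:
  fixes y y' :: "complex \<Rightarrow> complex^'m"
  assumes "0 < R" and K: "K \<le> real N"
    and deriv: "\<And>z. 0 < norm z \<Longrightarrow> norm z \<le> R \<Longrightarrow> vec_deriv y (y' z) z"
    and bound: "\<And>z. 0 < norm z \<Longrightarrow> norm z \<le> R \<Longrightarrow> norm z * norm (y' z) \<le> K * norm (y z)"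
  shows "\<exists>C. \<forall>z. 0 < norm z \<and> norm z \<le> R \<longrightarrow> norm z ^ N * norm (y z) \<le> C"
proof -
  have "continuous_on (sphere 0 R) y"
  proof (rule continuous_at_imp_continuous_on, rule ballI)
    fix z :: complex assume "z \<in> sphere 0 R"
    then have "vec_deriv y (y' z) z" using \<open>0 < R\<close> by (intro deriv) auto
    then show "isCont y z" by (rule has_derivative_continuous[OF vec_deriv_has_derivative])
  qed
  then have "bounded (y ` sphere 0 R)"
    by (intro compact_imp_bounded compact_continuous_image) auto
  then obtain C where C: "\<And>z. norm z = R \<Longrightarrow> norm (y z) \<le> C"
    unfolding bounded_iff by (metis imageI mem_sphere_0)
  have "norm z ^ N * norm (y z) \<le> R ^ N * C" if z: "0 < norm z" "norm z \<le> R" for z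
  proof -
    \<comment> \<open>The ray through \<open>z\<close> is \<open>s \<mapsto> s u\<close>.\<close>
    define u where "u = z / of_real (norm z)"
    have u: "norm u = 1" using z by (simp add: u_def norm_divide)
    then have "u \<noteq> 0" by auto
    define F where "F = (\<lambda>s. (s ^ N)\<^sup>2 * (y (of_real s * u) \<bullet> y (of_real s * u)))"
    have "F (norm z) \<le> F R"
    proof (rule DERIV_nonneg_imp_nondecreasing[OF z(2)])
      fix s assume s: "norm z \<le> s" "s \<le> R"
      then have "s > 0" using z by linarith
      define w where "w = of_real s * u"
      have w: "norm w = s" using u \<open>s > 0\<close> by (simp add: w_def norm_mult)
      have d1: "((\<lambda>t. y (of_real t * u)) has_vector_derivative u *s y' w) (at s)"
        using vec_deriv_along_line[of y "y' w" 0 s u] deriv[of w] w s \<open>s > 0\<close> \<open>u \<noteq> 0\<close> by (simp add: w_def)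
      then have d2: "((\<lambda>t. y (of_real t * u) \<bullet> y (of_real t * u)) has_real_derivative (2 * (y w \<bullet> (u *s y' w)))) (at s)"
        unfolding has_field_derivative_def has_vector_derivative_def
        by (intro has_derivative_eq_rhs[OF has_derivative_inner[OF d1[unfolded has_vector_derivative_def] d1[unfolded has_vector_derivative_def]]])
          (simp add: w_def inner_commute fun_eq_iff algebra_simps)
      have D: "(F has_real_derivative ((s ^ N)\<^sup>2 * (2 * (y w \<bullet> (u *s y' w)))
          + 2 * s ^ N * (real N * s ^ (N - 1)) * (y w \<bullet> y w))) (at s)"
        unfolding F_def by (rule derivative_eq_intros d2 refl)+ (simp add: w_def)
      have "- (y w \<bullet> (u *s y' w)) \<le> norm (y w) * norm (u *s y' w)"
        using Cauchy_Schwarz_ineq2[of "y w" "u *s y' w"] by linarith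
      also have "\<dots> = norm (y w) * norm (y' w)" using u by (simp add: norm_smult_vec)
      finally have "- (s * (y w \<bullet> (u *s y' w))) \<le> norm (y w) * (s * norm (y' w))"
        using mult_left_mono[of _ _ s] \<open>s > 0\<close> by (simp add: algebra_simps) (metis less_eq_real_def minus_mult_right mult.left_commute mult_left_mono)
      also have "\<dots> \<le> norm (y w) * (K * norm (y w))"
        using bound[of w] w s \<open>s > 0\<close> by (intro mult_left_mono) auto
      also have "\<dots> \<le> real N * (y w \<bullet> y w)"
        using mult_right_mono[OF K, of "y w \<bullet> y w"] by (simp add: dot_square_norm power2_eq_square algebra_simps)
      finally have ge: "0 \<le> s * (y w \<bullet> (u *s y' w)) + real N * (y w \<bullet> y w)" by linarith
      have eq: "s * s ^ (N - 1) * real N = real N * s ^ N"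
        by (cases N) auto
      have "s * ((s ^ N)\<^sup>2 * (2 * (y w \<bullet> (u *s y' w))) + 2 * s ^ N * (real N * s ^ (N - 1)) * (y w \<bullet> y w))
         = 2 * (s ^ N)\<^sup>2 * (s * (y w \<bullet> (u *s y' w))) + 2 * s ^ N * (s * s ^ (N - 1) * real N) * (y w \<bullet> y w)"
        by (simp add: algebra_simps)
      also have "\<dots> = 2 * (s ^ N)\<^sup>2 * (s * (y w \<bullet> (u *s y' w)) + real N * (y w \<bullet> y w))"
        unfolding eq by (simp add: algebra_simps power2_eq_square)
      also have "\<dots> \<ge> 0" using ge by simp
      finally have "0 \<le> (s ^ N)\<^sup>2 * (2 * (y w \<bullet> (u *s y' w))) + 2 * s ^ N * (real N * s ^ (N - 1)) * (y w \<bullet> y w)"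
        using \<open>s > 0\<close> by (simp add: zero_le_mult_iff)
      with D show "\<exists>D. (F has_real_derivative D) (at s) \<and> 0 \<le> D" by blast
    qed
    have Fsq: "F s = (s ^ N * norm (y (of_real s * u)))\<^sup>2" for s
      unfolding F_def dot_square_norm power_mult_distrib by (rule refl)
    have uz: "of_real (norm z) * u = z" using z by (simp add: u_def)
    have nn: "0 \<le> R ^ N * norm (y (of_real R * u))" using \<open>0 < R\<close> by simp
    have "norm z ^ N * norm (y z) \<le> R ^ N * norm (y (of_real R * u))"
      using power2_le_imp_le[OF \<open>F (norm z) \<le> F R\<close>[unfolded Fsq uz] nn] .
    also have "\<dots> \<le> R ^ N * C"
      using C[of "of_real R * u"] u \<open>0 < R\<close> by (intro mult_left_mono) (auto simp: norm_mult)
    finally show ?thesis .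
  qed
  then show ?thesis by blast
qed

text \<open>A pole can be lowered as long as there is one: the leading coefficient \<open>x\<close> of a solution with a pole of
  order \<open>k\<close> satisfies \<open>R x = -k x\<close>, where \<open>R = \<Sum> c i 0 * L i\<close> is the residue of the system at the origin.\<close>

lemma nonresonant_pole_order_zero:
  fixes y :: "complex \<Rightarrow> complex^'m" and L :: "'i \<Rightarrow> complex^'m \<Rightarrow> complex^'m" and c :: "'i \<Rightarrow> complex \<Rightarrow> complex"
  assumes I: "finite I" and lin: "\<And>i. i \<in> I \<Longrightarrow> Vector_Spaces.linear (*s) (*s) (L i)"
    and "0 < R" and deriv: "\<And>z. 0 < norm z \<Longrightarrow> norm z < R \<Longrightarrow>
      vec_deriv y ((1/z) *s (\<Sum>i\<in>I. c i z *s L i (y z))) z"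
    and cont: "\<And>i. i \<in> I \<Longrightarrow> (c i \<longlongrightarrow> c i 0) (at 0)"
    and nonres: "\<And>k x. (\<Sum>i\<in>I. c i 0 *s L i x) = - of_nat (Suc k) *s x \<Longrightarrow> x = 0"
    and growth: "\<exists>C r. 0 < r \<and> (\<forall>z. 0 < norm z \<and> norm z < r \<longrightarrow> norm z ^ N * norm (y z) \<le> C)"
  shows "\<exists>C r. 0 < r \<and> (\<forall>z. 0 < norm z \<and> norm z < r \<longrightarrow> norm (y z) \<le> C)"
  using growth
proof (induction N)
  case 0
  then show ?case by simp
next
  case (Suc N)
  then obtain C r0 where r0: "0 < r0" and C: "\<And>z. 0 < norm z \<Longrightarrow> norm z < r0 \<Longrightarrow> norm z ^ Suc N * norm (y z) \<le> C"
    by blast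
  define r where "r = min r0 R"
  have r: "0 < r" "r \<le> r0" "r \<le> R" using r0 \<open>0 < R\<close> unfolding r_def by simp_all
  have "\<exists>G. G holomorphic_on ball 0 r \<and> (\<forall>z\<in>ball 0 r - {0}. G z = z ^ Suc N * y z $ i)" for i
  proof (rule holomorphic_on_extend)
    have "(\<lambda>w. y w $ i) holomorphic_on ball 0 r - {0}"
      by (rule vec_deriv_holomorphic, rule deriv) (use r in auto)
    then show "(\<lambda>z. z ^ Suc N * y z $ i) holomorphic_on ball 0 r - {0}"
      by (intro holomorphic_intros)
    show "0 \<in> interior (ball (0::complex) r)" using r by simp
    have "\<forall>\<^sub>F z in at 0. norm (z ^ Suc N * y z $ i) \<le> C * norm (1::complex)"
      unfolding eventually_at
    proof (intro exI[of _ r] conjI ballI impI r)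
      fix z :: complex assume z: "z \<noteq> 0 \<and> dist z 0 < r"
      have "norm (z ^ Suc N * y z $ i) = norm z ^ Suc N * norm (y z $ i)"
        by (simp add: norm_mult norm_power)
      also have "\<dots> \<le> norm z ^ Suc N * norm (y z)"
        by (intro mult_left_mono Finite_Cartesian_Product.norm_nth_le) auto
      also have "\<dots> \<le> C" using C[of z] z r by auto
      finally show "norm (z ^ Suc N * y z $ i) \<le> C * norm (1::complex)" by simp
    qed
    then show "(\<lambda>z. z ^ Suc N * y z $ i) \<in> O[at 0](\<lambda>_. 1)"
      by (rule bigoI)
  qed
  then obtain G where holG: "\<And>i. G i holomorphic_on ball 0 r"
    and G: "\<And>i z. z \<in> ball 0 r - {0} \<Longrightarrow> G i z = z ^ Suc N * y z $ i" by metis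
  \<comment> \<open>\<open>g\<close> is the holomorphic extension of \<open>z ^ Suc N *s y z\<close> to the origin; its value there is the candidate for a leading coefficient.\<close>
  define g where "g = (\<lambda>z. \<chi> i. G i z)"
  have gy: "g z = z ^ Suc N *s y z" if "z \<in> ball 0 r - {0}" for z
    using G[OF that] by (simp add: g_def vec_eq_iff)
  have eqn: "z * deriv (G i) z = of_nat (Suc N) * G i z + (\<Sum>j\<in>I. c j z *s L j (g z)) $ i"
    if z: "z \<in> ball 0 r - {0}" for i z
  proof -
    have "((\<lambda>w. w ^ Suc N * y w $ i) has_field_derivative
       (of_nat (Suc N) * z ^ N * y z $ i + z ^ Suc N * ((1/z) *s (\<Sum>i\<in>I. c i z *s L i (y z))) $ i)) (at z)"
    proof -
      have "((\<lambda>w. w ^ Suc N) has_field_derivative of_nat (Suc N) * z ^ N) (at z)"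
        by (rule DERIV_cong[OF DERIV_power[OF DERIV_ident]]) simp
      moreover have "((\<lambda>w. y w $ i) has_field_derivative ((1/z) *s (\<Sum>i\<in>I. c i z *s L i (y z))) $ i) (at z)"
        using deriv[of z] z r unfolding vec_deriv_def by simp
      ultimately show ?thesis by (rule DERIV_cong[OF DERIV_mult]) (simp add: mult.commute)
    qed
    then have "(G i has_field_derivative
       (of_nat (Suc N) * z ^ N * y z $ i + z ^ Suc N * ((1/z) *s (\<Sum>i\<in>I. c i z *s L i (y z))) $ i)) (at z)"
      by (rule has_field_derivative_transform_within_open[where S="ball 0 r - {0}"]) (use z G in auto)
    then have "deriv (G i) z = of_nat (Suc N) * z ^ N * y z $ i + z ^ Suc N * ((1/z) *s (\<Sum>i\<in>I. c i z *s L i (y z))) $ i"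
      by (rule DERIV_imp_deriv)
    then have "z * deriv (G i) z = of_nat (Suc N) * (z ^ Suc N * y z $ i) + (z ^ Suc N *s (\<Sum>i\<in>I. c i z *s L i (y z))) $ i"
      using z by (simp add: field_simps)
    also have "z ^ Suc N *s (\<Sum>i\<in>I. c i z *s L i (y z)) = (\<Sum>j\<in>I. c j z *s L j (g z))"
      unfolding gy[OF z] vec.scale_sum_right
      by (intro sum.cong refl) (simp add: vec.linear_scale[OF lin] vector_smult_assoc mult_ac)
    finally show ?thesis using G[OF z] by simp
  qed
  have contG: "isCont (G i) 0" "isCont (deriv (G i)) 0" for i
    using holG[of i] r holomorphic_deriv[OF holG[of i]]
    by (auto intro!: continuous_on_interior holomorphic_on_imp_continuous_on)
  have limg: "(g \<longlongrightarrow> g 0) (at 0)"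
    unfolding g_def by (rule vec_tendstoI) (use contG in \<open>simp add: isCont_def\<close>)
  have "(\<Sum>j\<in>I. c j 0 *s L j (g 0)) = - of_nat (Suc N) *s g 0"
  proof -
    have "(0::complex) * deriv (G i) 0 = of_nat (Suc N) * G i 0 + (\<Sum>j\<in>I. c j 0 *s L j (g 0)) $ i" for i
    proof (rule tendsto_unique[of "at (0::complex)"])
      show "((\<lambda>z. z * deriv (G i) z) \<longlongrightarrow> 0 * deriv (G i) 0) (at 0)"
        using contG by (intro tendsto_intros) (auto simp: isCont_def)
      have "((\<lambda>z. of_nat (Suc N) * G i z + (\<Sum>j\<in>I. c j z *s L j (g z)) $ i) \<longlongrightarrow>
          of_nat (Suc N) * G i 0 + (\<Sum>j\<in>I. c j 0 *s L j (g 0)) $ i) (at 0)"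
        unfolding sum_component vector_smult_component
        using contG cont by (intro tendsto_intros bounded_linear.tendsto[OF vec_linear_bounded_linear[OF lin]] limg) (auto simp: isCont_def)
      moreover have "\<forall>\<^sub>F z in at 0. of_nat (Suc N) * G i z + (\<Sum>j\<in>I. c j z *s L j (g z)) $ i = z * deriv (G i) z"
        unfolding eventually_at using r eqn by (intro exI[of _ r]) (auto simp del: sum_component)
      ultimately show "((\<lambda>z. z * deriv (G i) z) \<longlongrightarrow>
          of_nat (Suc N) * G i 0 + (\<Sum>j\<in>I. c j 0 *s L j (g 0)) $ i) (at 0)"
        by (rule Lim_transform_eventually)
    qed simp
    then show ?thesis
      unfolding vec_eq_iff by (simp add: g_def add_eq_0_iff2 del: sum_component of_nat_Suc)
  qed
  then have g0: "g 0 = 0" by (rule nonres)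
  have "((\<lambda>z. G i z / z) \<longlongrightarrow> deriv (G i) 0) (at 0)" for i
  proof -
    have "(G i has_field_derivative deriv (G i) 0) (at 0)"
      using holomorphic_derivI[OF holG[of i]] r by simp
    moreover have "G i 0 = 0" using g0 by (simp add: g_def vec_eq_iff)
    ultimately show ?thesis by (simp add: has_field_derivative_iff)
  qed
  then have "((\<lambda>z. \<chi> i. G i z / z) \<longlongrightarrow> (\<chi> i. deriv (G i) 0)) (at 0)"
    by (intro vec_tendstoI) simp
  then have "((\<lambda>z. norm (\<chi> i. G i z / z)) \<longlongrightarrow> norm (\<chi> i. deriv (G i) 0)) (at 0)"
    by (rule tendsto_norm)
  then have "\<forall>\<^sub>F z in at 0. norm (\<chi> i. G i z / z) < norm (\<chi> i. deriv (G i) 0) + 1"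
    by (rule order_tendstoD) simp
  then obtain d where d: "d > 0" "\<And>z. z \<noteq> 0 \<Longrightarrow> dist z 0 < d \<Longrightarrow> norm (\<chi> i. G i z / z) < norm (\<chi> i. deriv (G i) 0) + 1"
    unfolding eventually_at by blast
  have "norm z ^ N * norm (y z) \<le> norm (\<chi> i. deriv (G i) 0) + 1" if z: "0 < norm z" "norm z < min d r" for z
  proof -
    have "(\<chi> i. G i z / z) = z ^ N *s y z"
      using z G[of z] by (simp add: vec_eq_iff)
    then show ?thesis using d(2)[of z] z by (simp add: norm_smult_vec norm_power)
  qed
  then have "\<exists>C r. 0 < r \<and> (\<forall>z. 0 < norm z \<and> norm z < r \<longrightarrow> norm z ^ N * norm (y z) \<le> C)"
    using d(1) r by (intro exI[of _ "norm (\<chi> i. deriv (G i) 0) + 1"] exI[of _ "min d r"]) auto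
  then show ?case by (rule Suc.IH)
qed

text \<open>The system is \<open>z y' = \<Sum> c i z * L i y\<close>. Allowing coefficients \<open>c i\<close> that are continuous
  at the origin covers both a finite singular point of a Fuchsian system and the point at infinity.\<close>

lemma nonresonant_bounded:
  fixes y :: "complex \<Rightarrow> complex^'m" and L :: "'i \<Rightarrow> complex^'m \<Rightarrow> complex^'m" and c :: "'i \<Rightarrow> complex \<Rightarrow> complex"
  assumes I: "finite I" and lin: "\<And>i. i \<in> I \<Longrightarrow> Vector_Spaces.linear (*s) (*s) (L i)"
    and "0 < R" and deriv: "\<And>z. 0 < norm z \<Longrightarrow> norm z < R \<Longrightarrow>
      vec_deriv y ((1/z) *s (\<Sum>i\<in>I. c i z *s L i (y z))) z"
    and cont: "\<And>i. i \<in> I \<Longrightarrow> (c i \<longlongrightarrow> c i 0) (at 0)"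
    and nonres: "\<And>k x. (\<Sum>i\<in>I. c i 0 *s L i x) = - of_nat (Suc k) *s x \<Longrightarrow> x = 0"
  shows "\<exists>C r. 0 < r \<and> (\<forall>z. 0 < norm z \<and> norm z < r \<longrightarrow> norm (y z) \<le> C)"
proof -
  have "\<forall>\<^sub>F z in at 0. \<forall>i\<in>I. norm (c i z) < norm (c i 0) + 1"
    using I cont by (intro eventually_ball_finite ballI order_tendstoD(2)[OF tendsto_norm]) auto
  then obtain d where d: "d > 0" "\<And>z i. z \<noteq> 0 \<Longrightarrow> norm z < d \<Longrightarrow> i \<in> I \<Longrightarrow> norm (c i z) < norm (c i 0) + 1"
    unfolding eventually_at by (auto simp: dist_norm)
  define B where "B = (\<lambda>i. onorm (L i))"
  have B: "norm (L i x) \<le> B i * norm x" "0 \<le> B i" if "i \<in> I" for i x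
    using onorm[OF vec_linear_bounded_linear[OF lin[OF that]]] onorm_pos_le[OF vec_linear_bounded_linear[OF lin[OF that]]]
    by (auto simp: B_def)
  define K where "K = (\<Sum>i\<in>I. (norm (c i 0) + 1) * B i)"
  obtain N where N: "K \<le> real N" using real_arch_simple by blast
  define r where "r = min d R / 2"
  have r: "0 < r" "r < d" "r < R" using d \<open>0 < R\<close> by (auto simp: r_def)
  have "\<exists>C. \<forall>z. 0 < norm z \<and> norm z \<le> r \<longrightarrow> norm z ^ N * norm (y z) \<le> C"
  proof (rule fuchsian_growth[OF r(1) N])
    fix z :: complex assume z: "0 < norm z" "norm z \<le> r"
    show "vec_deriv y ((1/z) *s (\<Sum>i\<in>I. c i z *s L i (y z))) z"
      using deriv z r by simp
    have "norm z * norm ((1/z) *s (\<Sum>i\<in>I. c i z *s L i (y z))) = norm (\<Sum>i\<in>I. c i z *s L i (y z))"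
      using z by (simp add: norm_smult_vec norm_divide)
    also have "\<dots> \<le> (\<Sum>i\<in>I. norm (c i z) * norm (L i (y z)))"
      by (rule order_trans[OF norm_sum]) (simp add: norm_smult_vec)
    also have "\<dots> \<le> (\<Sum>i\<in>I. (norm (c i 0) + 1) * (B i * norm (y z)))"
      using z r d(2)[of z] B by (intro sum_mono mult_mono) (auto simp: less_imp_le)
    also have "\<dots> = K * norm (y z)" 
      unfolding K_def sum_distrib_right by (intro sum.cong) (simp_all add: mult_ac)
    finally show "norm z * norm ((1/z) *s (\<Sum>i\<in>I. c i z *s L i (y z))) \<le> K * norm (y z)" .
  qed
  then have "\<exists>C r. 0 < r \<and> (\<forall>z. 0 < norm z \<and> norm z < r \<longrightarrow> norm z ^ N * norm (y z) \<le> C)"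
    using r(1) by (meson less_imp_le)
  then show ?thesis
    by (rule nonresonant_pole_order_zero[OF I lin \<open>0 < R\<close> deriv cont nonres, rotated -1])
qed

text \<open>Non-resonance at each finite singular point and at infinity makes the single-valued solution \<open>f\<close> bounded
  there; the singularities are then removable and Liouville's theorem applies. At infinity the residue is
  \<open>- \<Sum> L i\<close>, whence the opposite sign in the last hypothesis.\<close>

lemma nonresonant_fuchsian_constant:
  fixes f :: "complex \<Rightarrow> complex^'m" and L :: "'i \<Rightarrow> complex^'m \<Rightarrow> complex^'m" and t :: "'i \<Rightarrow> complex"
  assumes I: "finite I" and inj: "inj_on t I"
    and lin: "\<And>i. i \<in> I \<Longrightarrow> Vector_Spaces.linear (*s) (*s) (L i)"
    and deriv: "\<And>z. z \<notin> t ` I \<Longrightarrow> vec_deriv f (\<Sum>i\<in>I. (1 / (z - t i)) *s L i (f z)) z"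
    and nonres: "\<And>i k x. i \<in> I \<Longrightarrow> L i x = - of_nat (Suc k) *s x \<Longrightarrow> x = 0"
    and nonres_inf: "\<And>k x. (\<Sum>i\<in>I. L i x) = of_nat (Suc k) *s x \<Longrightarrow> x = 0"
  shows "\<exists>x. \<forall>z. z \<notin> t ` I \<longrightarrow> f z = x"
proof -
  have near: "\<exists>C r. 0 < r \<and> (\<forall>z. 0 < norm z \<and> norm z < r \<longrightarrow> norm (f (t j + z)) \<le> C)" if j: "j \<in> I" for j
  proof -
    have "\<forall>\<^sub>F z in at (t j). z \<notin> t ` I"
      using I islimpt_finite[of "t ` I" "t j"] by (simp add: islimpt_iff_eventually)
    then obtain R where R: "R > 0" "\<And>z. z \<noteq> t j \<Longrightarrow> dist z (t j) < R \<Longrightarrow> z \<notin> t ` I"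
      unfolding eventually_at by blast
    \<comment> \<open>The coefficients of \<open>L i\<close> in \<open>z f'(t j + z)\<close>. The singular term has coefficient \<open>1\<close>, also at \<open>z = 0\<close>.\<close>
    define c where "c = (\<lambda>i z. if i = j then 1 else z / (z + t j - t i))"
    show ?thesis
    proof (rule nonresonant_bounded[OF I lin R(1), where c=c])
      fix z :: complex assume z: "0 < norm z" "norm z < R"
      have "t j + z \<notin> t ` I" using z by (intro R) (auto simp: dist_norm)
      then have "vec_deriv f (\<Sum>i\<in>I. (1 / (t j + z - t i)) *s L i (f (t j + z))) (t j + z)"
        by (rule deriv)
      then have "vec_deriv (\<lambda>z. f (t j + z)) (\<Sum>i\<in>I. (1 / (t j + z - t i)) *s L i (f (t j + z))) z"
        unfolding vec_deriv_def by (simp add: DERIV_shift add.commute del: sum_component)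
      also have "(\<Sum>i\<in>I. (1 / (t j + z - t i)) *s L i (f (t j + z))) = (1/z) *s (\<Sum>i\<in>I. c i z *s L i (f (t j + z)))"
        unfolding vec.scale_sum_right
        by (intro sum.cong refl) (use z in \<open>auto simp: c_def vector_smult_assoc add.commute\<close>)
      finally show "vec_deriv (\<lambda>z. f (t j + z)) ((1/z) *s (\<Sum>i\<in>I. c i z *s L i (f (t j + z)))) z" .
    next
      fix i assume i: "i \<in> I"
      show "(c i \<longlongrightarrow> c i 0) (at 0)"
      proof (cases "i = j")
        case False
        then have "t j \<noteq> t i" using inj i j by (auto simp: inj_on_def)
        then have "((\<lambda>z. z / (z + t j - t i)) \<longlongrightarrow> 0 / (0 + t j - t i)) (at 0)"
          by (intro tendsto_intros) auto
        then show ?thesis using False by (simp add: c_def)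
      qed (simp add: c_def)
    next
      fix k x assume "(\<Sum>i\<in>I. c i 0 *s L i x) = - of_nat (Suc k) *s x"
      moreover have "(\<Sum>i\<in>I. c i 0 *s L i x) = (\<Sum>i\<in>I. if i = j then L i x else 0)"
        by (intro sum.cong) (auto simp: c_def)
      ultimately have "L j x = - of_nat (Suc k) *s x" using I j by simp
      then show "x = 0" by (rule nonres[OF j])
    qed
  qed
  have far: "\<exists>C r. 0 < r \<and> (\<forall>z. 0 < norm z \<and> norm z < r \<longrightarrow> norm (f (1 / z)) \<le> C)"
  proof -
    define M where "M = Max (insert 1 ((\<lambda>i. norm (t i)) ` I))"
    have M: "1 \<le> M" "\<And>i. i \<in> I \<Longrightarrow> norm (t i) \<le> M"
      using I by (auto simp: M_def)
    \<comment> \<open>In the coordinate \<open>1/z\<close> the term \<open>L i / (z - t i)\<close> acquires the factor \<open>- 1 / z\<^sup>2\<close>.\<close>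
    define c where "c = (\<lambda>i z. - 1 / (1 - t i * z))"
    show ?thesis
    proof (rule nonresonant_bounded[OF I lin, where c=c and R="1/M"])
      show "0 < 1/M" using M by simp
      fix z :: complex assume z: "0 < norm z" "norm z < 1/M"
      have nz: "1 - t i * z \<noteq> 0" if "i \<in> I" for i
      proof
        assume "1 - t i * z = 0"
        then have "norm (t i) * norm z = 1" by (metis eq_iff_diff_eq_0 norm_mult norm_one)
        moreover have "norm (t i) * norm z \<le> M * norm z" using M(2)[OF that] by (intro mult_right_mono) auto
        moreover have "M * norm z < 1" using z M by (simp add: field_simps)
        ultimately show False by linarith
      qed
      have "1/z \<notin> t ` I" using nz z by (auto simp: field_simps)
      then have "vec_deriv f (\<Sum>i\<in>I. (1 / (1/z - t i)) *s L i (f (1/z))) (1/z)" by (rule deriv)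
      then have "vec_deriv (\<lambda>z. f (1/z)) ((- 1 / z\<^sup>2) *s (\<Sum>i\<in>I. (1 / (1/z - t i)) *s L i (f (1/z)))) z"
        unfolding vec_deriv_def
      proof (intro allI)
        fix i assume "\<forall>i. ((\<lambda>w. f w $ i) has_field_derivative (\<Sum>i\<in>I. (1 / (1/z - t i)) *s L i (f (1/z))) $ i) (at (1/z))"
        then have "((\<lambda>w. f w $ i) has_field_derivative (\<Sum>i\<in>I. (1 / (1/z - t i)) *s L i (f (1/z))) $ i) (at (1/z))" by blast
        moreover have "((\<lambda>w. 1/w) has_field_derivative (- 1 / z\<^sup>2)) (at z)"
          using DERIV_inverse[of z] z by (simp add: divide_inverse power2_eq_square)
        ultimately show "((\<lambda>z. f (1/z) $ i) has_field_derivative ((- 1 / z\<^sup>2) *s (\<Sum>i\<in>I. (1 / (1/z - t i)) *s L i (f (1/z)))) $ i) (at z)"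
          unfolding vector_smult_component by (rule DERIV_cong[OF DERIV_chain2]) simp
      qed
      also have "((- 1 / z\<^sup>2) *s (\<Sum>i\<in>I. (1 / (1/z - t i)) *s L i (f (1/z)))) = (1/z) *s (\<Sum>i\<in>I. c i z *s L i (f (1/z)))"
        unfolding vec.scale_sum_right
      proof (intro sum.cong refl)
        fix i assume i: "i \<in> I"
        have "z * (1/z - t i) = 1 - t i * z" using z by (simp add: right_diff_distrib mult.commute)
        then have "(- 1 / z\<^sup>2) * (1 / (1/z - t i)) = (1/z) * c i z"
          using z nz[OF i] unfolding c_def power2_eq_square by (simp add: mult.assoc)
        then show "(- 1 / z\<^sup>2) *s ((1 / (1/z - t i)) *s L i (f (1/z))) = (1/z) *s (c i z *s L i (f (1/z)))"
          unfolding vector_smult_assoc by simp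
      qed
      finally show "vec_deriv (\<lambda>z. f (1/z)) ((1/z) *s (\<Sum>i\<in>I. c i z *s L i (f (1/z)))) z" .
    next
      fix i assume "i \<in> I"
      have "((\<lambda>z. - 1 / (1 - t i * z)) \<longlongrightarrow> - 1 / (1 - t i * 0)) (at 0)"
        by (intro tendsto_intros) auto
      then show "(c i \<longlongrightarrow> c i 0) (at 0)" by (simp add: c_def)
    next
      fix k x assume "(\<Sum>i\<in>I. c i 0 *s L i x) = - of_nat (Suc k) *s x"
      then have "- (\<Sum>i\<in>I. L i x) = - (of_nat (Suc k) *s x)"
        by (simp add: c_def sum_negf vector_smult_lneg)
      then have "(\<Sum>i\<in>I. L i x) = of_nat (Suc k) *s x" by (simp only: neg_equal_iff_equal)
      then show "x = 0" by (rule nonres_inf)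
    qed
  qed
  obtain Cinf rinf where inf: "0 < rinf" "\<And>z. 0 < norm z \<Longrightarrow> norm z < rinf \<Longrightarrow> norm (f (1/z)) \<le> Cinf"
    using far by blast
  have hol: "(\<lambda>z. f z $ i) holomorphic_on UNIV - t ` I" for i
    by (rule vec_deriv_holomorphic, rule deriv) auto
  have const: "\<exists>x. \<forall>z. z \<notin> t ` I \<longrightarrow> f z $ i = x" for i
  proof -
    have "\<exists>F. F holomorphic_on UNIV \<and> (\<forall>z\<in>UNIV - t ` I. F z = f z $ i)"
    proof (rule removable_singularities)
      fix z assume "z \<in> t ` I"
      then obtain j where j: "j \<in> I" "z = t j" by blast
      obtain C r where r: "0 < r" "\<And>z. 0 < norm z \<Longrightarrow> norm z < r \<Longrightarrow> norm (f (t j + z)) \<le> C"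
        using near[OF j(1)] by blast
      have "\<forall>\<^sub>F w in at z. norm (f w $ i) \<le> C * norm (1::complex)"
        unfolding eventually_at
      proof (intro exI[of _ r] conjI ballI impI r)
        fix w assume "w \<noteq> z \<and> dist w z < r"
        then have "norm (f w) \<le> C" using r(2)[of "w - z"] j by (simp add: dist_norm)
        then show "norm (f w $ i) \<le> C * norm (1::complex)"
          using Finite_Cartesian_Product.norm_nth_le[of "f w" i] by simp
      qed
      then show "(\<lambda>z. f z $ i) \<in> O[at z](\<lambda>_. 1)" by (rule bigoI)
    qed (use I hol in auto)
    then obtain F where F: "F holomorphic_on UNIV" "\<And>z. z \<notin> t ` I \<Longrightarrow> F z = f z $ i" by blast
    have "bounded (range F)"
    proof -
      have "bounded (F ` cball 0 (1 / rinf))"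
        using F(1) by (intro compact_imp_bounded compact_continuous_image)
          (auto intro: holomorphic_on_imp_continuous_on holomorphic_on_subset)
      moreover obtain M where M: "\<And>i. i \<in> I \<Longrightarrow> norm (F (t i)) \<le> M"
        using finite_imp_bounded[of "(\<lambda>i. F (t i)) ` I"] I by (auto simp: bounded_iff)
      moreover have "norm (F z) \<le> Cinf" if "1 / rinf < norm z" "z \<notin> t ` I" for z
      proof -
        have "0 < norm z" using that(1) inf(1) by (smt (verit) divide_pos_pos)
        moreover from this have "norm (1/z) < rinf" using that(1) inf(1) by (simp add: norm_divide field_simps)
        ultimately have "norm (f (1/(1/z))) \<le> Cinf" by (intro inf(2)) auto
        then show ?thesis using F(2)[OF that(2)] Finite_Cartesian_Product.norm_nth_le[of "f z" i] by simp
      qed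
      ultimately show ?thesis
        unfolding bounded_iff
      proof -
        assume "\<exists>a. \<forall>x\<in>F ` cball 0 (1 / rinf). norm x \<le> a"
        then obtain a where a: "\<And>z. norm z \<le> 1 / rinf \<Longrightarrow> norm (F z) \<le> a" by (metis imageI mem_cball_0)
        assume M: "\<And>i. i \<in> I \<Longrightarrow> norm (F (t i)) \<le> M"
        assume c: "\<And>z. 1 / rinf < norm z \<Longrightarrow> z \<notin> t ` I \<Longrightarrow> norm (F z) \<le> Cinf"
        have "norm (F z) \<le> max a (max M Cinf)" for z
          using a[of z] c[of z] M by (cases "z \<in> t ` I"; cases "norm z \<le> 1 / rinf") (auto simp: le_max_iff_disj)
        then show "\<exists>a. \<forall>x\<in>range F. norm x \<le> a" by blast
      qed
    qed
    then have "F constant_on UNIV" using F(1) by (rule Liouville_theorem[rotated])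
    then show ?thesis using F(2) by (auto simp: constant_on_def)
  qed
  then obtain x where x: "\<And>i z. z \<notin> t ` I \<Longrightarrow> f z $ i = x i" by metis
  then show ?thesis by (intro exI[of _ "\<chi> i. x i"]) (simp add: vec_eq_iff)
qed

section \<open>Linear systems of differential equations on a planar domain\<close>

text \<open>Taylor coefficients of the solution of \<open>y' = B y\<close> with \<open>y(0) = c\<close>, where \<open>b i j\<close> is the coefficient sequence of the
  entry \<open>B i j\<close>.\<close>

fun ode_coeff :: "('n::finite \<Rightarrow> 'n \<Rightarrow> nat \<Rightarrow> complex) \<Rightarrow> complex^'n \<Rightarrow> nat \<Rightarrow> complex^'n" where
  "ode_coeff b c 0 = c"
| "ode_coeff b c (Suc k) = (\<chi> i. (\<Sum>l\<le>k. \<Sum>j\<in>UNIV. b i j l * ode_coeff b c (k - l) $ j) / of_nat (Suc k))"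

text \<open>The recursion divides a sum of \<open>Suc k\<close> convolution terms by \<open>Suc k\<close>, so a geometric bound on the entries of \<open>B\<close>
  propagates to a geometric bound on the solution.\<close>

lemma ode_coeff_bound:
  fixes b :: "'n::finite \<Rightarrow> 'n \<Rightarrow> nat \<Rightarrow> complex"
  assumes "0 \<le> K" "0 \<le> M" and b: "\<And>i j l. norm (b i j l) \<le> K * M ^ l"
  shows "norm (ode_coeff b c k $ i) \<le> norm c * (M + real CARD('n) * K) ^ k"
proof (induction k arbitrary: i rule: less_induct)
  case (less k)
  define Q where "Q = M + real CARD('n) * K"
  have Q: "M \<le> Q" "0 \<le> Q" "real CARD('n) * K \<le> Q" using assms by (simp_all add: Q_def)
  show ?case
  proof (cases k)
    case 0
    then show ?thesis by (simp add: Finite_Cartesian_Product.norm_nth_le)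
  next
    case (Suc m)
    have "norm (\<Sum>l\<le>m. \<Sum>j\<in>UNIV. b i j l * ode_coeff b c (m - l) $ j)
        \<le> (\<Sum>l\<le>m. \<Sum>j\<in>(UNIV::'n set). K * (norm c * Q ^ m))"
    proof (intro sum_norm_le)
      fix l j assume l: "l \<in> {..m}"
      have "norm (b i j l * ode_coeff b c (m - l) $ j) \<le> (K * M ^ l) * (norm c * Q ^ (m - l))"
        unfolding norm_mult Q_def using less.IH[of "m - l" j] Suc assms(1,2) by (intro mult_mono b) auto
      also have "\<dots> \<le> (K * Q ^ l) * (norm c * Q ^ (m - l))"
        using assms(1,2) Q by (intro mult_right_mono mult_left_mono power_mono) auto
      also have "\<dots> = K * (norm c * Q ^ m)"
        using l by (simp add: power_add[symmetric] mult.assoc mult.left_commute)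
      finally show "norm (b i j l * ode_coeff b c (m - l) $ j) \<le> K * (norm c * Q ^ m)" .
    qed
    also have "\<dots> = real (Suc m) * (real CARD('n) * K * (norm c * Q ^ m))" by simp
    also have "\<dots> \<le> real (Suc m) * (Q * (norm c * Q ^ m))"
      using Q by (intro mult_left_mono mult_right_mono) auto
    finally have le: "norm (\<Sum>l\<le>m. \<Sum>j\<in>UNIV. b i j l * ode_coeff b c (m - l) $ j)
        \<le> real (Suc m) * (Q * (norm c * Q ^ m))" .
    have "norm (ode_coeff b c k $ i) = norm (\<Sum>l\<le>m. \<Sum>j\<in>UNIV. b i j l * ode_coeff b c (m - l) $ j) / real (Suc m)"
      unfolding Suc by (simp add: norm_divide del: of_nat_Suc)
    also have "\<dots> \<le> real (Suc m) * (Q * (norm c * Q ^ m)) / real (Suc m)"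
      by (rule divide_right_mono[OF le]) simp
    also have "\<dots> = norm c * Q ^ k" unfolding Suc by simp
    finally show ?thesis unfolding Q_def .
  qed
qed

lemma eval_fps_sum_mult:
  fixes f g :: "'a \<Rightarrow> complex fps"
  assumes "finite J" and "\<And>j. j \<in> J \<Longrightarrow> ereal (norm w) < fps_conv_radius (f j)"
    and "\<And>j. j \<in> J \<Longrightarrow> ereal (norm w) < fps_conv_radius (g j)"
  shows "ereal (norm w) < fps_conv_radius (\<Sum>j\<in>J. f j * g j) \<and>
    eval_fps (\<Sum>j\<in>J. f j * g j) w = (\<Sum>j\<in>J. eval_fps (f j) w * eval_fps (g j) w)"
  using assms
proof (induction J)
  case empty
  show ?case by simp
next
  case (insert j J)
  have r: "ereal (norm w) < fps_conv_radius (f j * g j)"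
    using insert.prems by (intro less_le_trans[OF _ fps_conv_radius_mult]) auto
  have IH: "ereal (norm w) < fps_conv_radius (\<Sum>j\<in>J. f j * g j)"
    "eval_fps (\<Sum>j\<in>J. f j * g j) w = (\<Sum>j\<in>J. eval_fps (f j) w * eval_fps (g j) w)"
    using insert by auto
  have "ereal (norm w) < fps_conv_radius (f j * g j + (\<Sum>j\<in>J. f j * g j))"
    using r IH(1) by (intro less_le_trans[OF _ fps_conv_radius_add]) auto
  moreover have "eval_fps (f j * g j + (\<Sum>j\<in>J. f j * g j)) w = eval_fps (f j) w * eval_fps (g j) w + (\<Sum>j\<in>J. eval_fps (f j) w * eval_fps (g j) w)"
    using r IH insert.prems by (simp add: eval_fps_add eval_fps_mult)
  ultimately show ?case using insert.hyps by simp
qed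

text \<open>The formal power series solution converges on a disc whose radius does not depend on the
  initial value.\<close>

lemma local_linear_ode:
  fixes B :: "complex \<Rightarrow> complex^'n^'n"
  assumes "open S" "z0 \<in> S" and hol: "\<And>i j. (\<lambda>z. B z $ i $ j) holomorphic_on S"
  shows "\<exists>r>0. ball z0 r \<subseteq> S \<and>
    (\<forall>c. \<exists>y. y z0 = c \<and> (\<forall>z\<in>ball z0 r. vec_deriv y (B z *v y z) z))"
proof -
  obtain R where R: "R > 0" "ball z0 R \<subseteq> S" using assms(1,2) open_contains_ball by blast
  define b where "b = (\<lambda>i j. fps_expansion (\<lambda>z. B z $ i $ j) z0)"
  have holb: "(\<lambda>z. B z $ i $ j) holomorphic_on eball z0 (ereal R)" for i j
    by (rule holomorphic_on_subset[OF hol]) (use R in simp)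
  have radius: "ereal R \<le> fps_conv_radius (b i j)" for i j
    unfolding b_def by (rule conv_radius_fps_expansion[OF holb])
  have evalb: "eval_fps (b i j) (z - z0) = B z $ i $ j" if "z \<in> ball z0 R" for i j z
    unfolding b_def by (rule eval_fps_expansion[OF holb]) (use that in simp)
  define \<rho> where "\<rho> = R / 2"
  have \<rho>: "0 < \<rho>" "\<rho> < R" using R by (simp_all add: \<rho>_def)
  have "\<exists>K\<ge>0. \<forall>l. norm (fps_nth (b i j) l) * \<rho> ^ l \<le> K" for i j
  proof -
    have "ereal (norm (complex_of_real \<rho>)) < ereal R" using \<rho> by simp
    then have "summable (\<lambda>l. fps_nth (b i j) l * of_real \<rho> ^ l)"
      by (intro summable_fps less_le_trans[OF _ radius])
    then have "Bseq (\<lambda>l. fps_nth (b i j) l * of_real \<rho> ^ l)"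
      using summable_LIMSEQ_zero convergentI convergent_imp_Bseq by blast
    then obtain K where "K > 0" "\<And>l. norm (fps_nth (b i j) l * of_real \<rho> ^ l) \<le> K"
      by (auto elim: BseqE)
    then show ?thesis using \<rho> by (intro exI[of _ K]) (auto simp: norm_mult norm_power)
  qed
  then obtain Kf where Kf: "\<And>i j. 0 \<le> Kf i j" "\<And>i j l. norm (fps_nth (b i j) l) * \<rho> ^ l \<le> Kf i j"
    by metis
  define K where "K = (\<Sum>i\<in>UNIV. \<Sum>j\<in>UNIV. Kf i j)"
  have K0: "0 \<le> K" unfolding K_def by (intro sum_nonneg Kf)
  have KfK: "Kf i j \<le> K" for i j
  proof -
    have "Kf i j \<le> (\<Sum>j\<in>UNIV. Kf i j)" by (rule member_le_sum) (auto simp: Kf)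
    also have "\<dots> \<le> K" unfolding K_def by (rule member_le_sum[of i UNIV "\<lambda>i. \<Sum>j\<in>UNIV. Kf i j"]) (auto intro!: sum_nonneg Kf)
    finally show ?thesis .
  qed
  have bK: "norm (fps_nth (b i j) l) \<le> K * (1 / \<rho>) ^ l" for i j l
  proof -
    have "norm (fps_nth (b i j) l) * \<rho> ^ l \<le> K" using Kf(2) KfK order_trans by blast
    then show ?thesis using \<rho> by (simp add: power_one_over pos_le_divide_eq)
  qed
  define Q where "Q = 1 / \<rho> + real CARD('n) * K"
  have Q: "0 < Q" using \<rho> K0 by (simp add: Q_def add_pos_nonneg)
  \<comment> \<open>The coefficients of the solution grow at most like \<open>Q ^ k\<close>; half of the radius \<open>1 / Q\<close> leaves a convergent geometric series.\<close>
  define r where "r = min \<rho> (1 / (2 * Q))"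
  have r: "0 < r" "r \<le> \<rho>" "r \<le> 1 / (2 * Q)" using \<rho> Q by (simp_all add: r_def)
  have "\<exists>y. y z0 = c \<and> (\<forall>z\<in>ball z0 r. vec_deriv y (B z *v y z) z)" for c :: "complex^'n"
  proof -
    define s where "s = ode_coeff (\<lambda>i j l. fps_nth (b i j) l) c"
    define Sf where "Sf = (\<lambda>i. Abs_fps (\<lambda>k. s k $ i))"
    have sb: "norm (s k $ i) \<le> norm c * Q ^ k" for k i
      unfolding s_def Q_def using K0 \<rho> bK by (intro ode_coeff_bound) auto
    have radS: "ereal (1 / (2 * Q)) \<le> fps_conv_radius (Sf i)" for i
    proof -
      have "summable (\<lambda>k. s k $ i * of_real (1 / (2 * Q)) ^ k)"
      proof (rule summable_comparison_test')
        show "summable (\<lambda>k. norm c * (1 / 2) ^ k)" by (intro summable_mult summable_geometric) simp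
        fix k :: nat
        have "norm (s k $ i * of_real (1 / (2 * Q)) ^ k) = norm (s k $ i) * (1 / (2 * Q)) ^ k"
          using Q by (simp only: norm_mult norm_power norm_of_real abs_of_pos zero_less_divide_iff zero_less_mult_iff) simp
        also have "\<dots> \<le> norm c * Q ^ k * (1 / (2 * Q)) ^ k"
          using Q sb by (intro mult_right_mono) auto
        also have "\<dots> = norm c * (Q * (1 / (2 * Q))) ^ k"
          by (simp only: power_mult_distrib mult.assoc)
        also have "Q * (1 / (2 * Q)) = 1 / 2" using Q by simp
        finally show "norm (s k $ i * of_real (1 / (2 * Q)) ^ k) \<le> norm c * (1 / 2) ^ k" .
      qed
      then have "ereal (norm (complex_of_real (1 / (2 * Q)))) \<le> conv_radius (\<lambda>k. s k $ i)"
        by (rule conv_radius_geI)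
      moreover have "norm (complex_of_real (1 / (2 * Q))) = 1 / (2 * Q)"
        using Q by (simp only: norm_of_real) simp
      moreover have "fps_nth (Sf i) = (\<lambda>k. s k $ i)" by (simp add: Sf_def fun_eq_iff)
      ultimately show ?thesis by (simp only: fps_conv_radius_def)
    qed
    have ode: "fps_deriv (Sf i) = (\<Sum>j\<in>UNIV. b i j * Sf j)" for i
    proof (rule fps_ext)
      fix k
      have "fps_nth (fps_deriv (Sf i)) k = of_nat (Suc k) * (s (Suc k) $ i)"
        by (simp add: Sf_def del: of_nat_Suc)
      also have "\<dots> = (\<Sum>l\<le>k. \<Sum>j\<in>UNIV. fps_nth (b i j) l * s (k - l) $ j)"
        unfolding s_def by (simp del: of_nat_Suc)
      also have "\<dots> = (\<Sum>j\<in>UNIV. \<Sum>l\<le>k. fps_nth (b i j) l * s (k - l) $ j)"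
        by (rule sum.swap)
      also have "\<dots> = fps_nth (\<Sum>j\<in>UNIV. b i j * Sf j) k"
        by (simp add: fps_sum_nth fps_mult_nth Sf_def atLeast0AtMost)
      finally show "fps_nth (fps_deriv (Sf i)) k = fps_nth (\<Sum>j\<in>UNIV. b i j * Sf j) k" .
    qed
    define y where "y = (\<lambda>z. \<chi> i. eval_fps (Sf i) (z - z0))"
    have "y z0 = c"
      by (simp add: y_def vec_eq_iff eval_fps_at_0 Sf_def s_def)
    moreover have "vec_deriv y (B z *v y z) z" if z: "z \<in> ball z0 r" for z
      unfolding vec_deriv_def
    proof
      fix i
      have zr: "norm (z - z0) < r" using z by (simp add: dist_norm norm_minus_commute)
      have rad: "ereal (norm (z - z0)) < fps_conv_radius (Sf i)" for i
        using zr r by (intro less_le_trans[OF _ radS]) simp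
      have radb: "ereal (norm (z - z0)) < fps_conv_radius (b i j)" for i j
        using zr r \<rho> by (intro less_le_trans[OF _ radius]) simp
      have "(eval_fps (Sf i) has_field_derivative eval_fps (fps_deriv (Sf i)) (z - z0)) (at (z - z0))"
        by (rule has_field_derivative_eval_fps[OF rad])
      then have "((\<lambda>z. eval_fps (Sf i) (z - z0)) has_field_derivative eval_fps (fps_deriv (Sf i)) (z - z0) * 1) (at z)"
        by (rule DERIV_chain2) (auto intro!: derivative_eq_intros)
      moreover have "eval_fps (fps_deriv (Sf i)) (z - z0) = (\<Sum>j\<in>UNIV. B z $ i $ j * eval_fps (Sf j) (z - z0))"
      proof -
        have "eval_fps (fps_deriv (Sf i)) (z - z0) = (\<Sum>j\<in>UNIV. eval_fps (b i j) (z - z0) * eval_fps (Sf j) (z - z0))"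
          unfolding ode by (rule eval_fps_sum_mult[THEN conjunct2]) (auto simp: rad radb)
        moreover have "z \<in> ball z0 R" using z r \<rho> by auto
        ultimately show ?thesis by (simp add: evalb)
      qed
      ultimately show "((\<lambda>w. y w $ i) has_field_derivative (B z *v y z) $ i) (at z)"
        by (simp add: y_def matrix_vector_mult_def)
    qed
    ultimately show ?thesis by blast
  qed
  moreover have "ball z0 r \<subseteq> S" using R r \<rho> by auto
  ultimately show ?thesis using r(1) by blast
qed

definition mat_deriv :: "(complex \<Rightarrow> complex^'m^'n) \<Rightarrow> complex^'m^'n \<Rightarrow> complex \<Rightarrow> bool" where
  "mat_deriv F F' z \<longleftrightarrow> (\<forall>i j. ((\<lambda>w. F w $ i $ j) has_field_derivative F' $ i $ j) (at z))"

lemma mat_deriv_mult: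
  assumes "mat_deriv F F' z" "mat_deriv G G' z"
  shows "mat_deriv (\<lambda>w. F w ** G w) (F' ** G z + F z ** G') z"
  unfolding mat_deriv_def
proof (intro allI)
  fix i j
  have "((\<lambda>w. \<Sum>k\<in>UNIV. F w $ i $ k * G w $ k $ j) has_field_derivative
      (\<Sum>k\<in>UNIV. F' $ i $ k * G z $ k $ j + G' $ k $ j * F z $ i $ k)) (at z)"
    using assms unfolding mat_deriv_def by (intro DERIV_sum DERIV_mult) auto
  then show "((\<lambda>w. (F w ** G w) $ i $ j) has_field_derivative (F' ** G z + F z ** G') $ i $ j) (at z)"
    by (simp add: matrix_matrix_mult_def sum.distrib mult.commute)
qed

lemma mat_deriv_const: "mat_deriv (\<lambda>_. K) 0 z"
  by (simp add: mat_deriv_def)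

lemma mat_deriv_zero_constant:
  fixes F :: "complex \<Rightarrow> complex^'m^'n"
  assumes "convex D" "\<And>z. z \<in> D \<Longrightarrow> mat_deriv F 0 z" "a \<in> D" "b \<in> D"
  shows "F a = F b"
proof -
  have "F a $ i $ j = F b $ i $ j" for i j
  proof -
    have "((\<lambda>w. F w $ i $ j) has_field_derivative 0) (at z within D)" if "z \<in> D" for z
    proof (rule has_field_derivative_at_within)
      show "((\<lambda>w. F w $ i $ j) has_field_derivative 0) (at z)"
        using assms(2)[OF that, unfolded mat_deriv_def, rule_format, of i j] by (simp only: zero_index)
    qed
    then obtain k where "\<forall>z\<in>D. F z $ i $ j = k"
      using has_field_derivative_zero_constant[OF assms(1), of "\<lambda>w. F w $ i $ j"] by blast
    then show ?thesis using assms(3,4) by simp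
  qed
  then show ?thesis by (simp add: vec_eq_iff)
qed

text \<open>\<open>\<Phi>\<close> is a fundamental matrix of \<open>y' = B y\<close>. Its inverse \<open>\<Psi>\<close> is carried along, with its own
  differential equation.\<close>

definition flat_frame :: "(complex \<Rightarrow> complex^'n^'n) \<Rightarrow> complex set \<Rightarrow>
    (complex \<Rightarrow> complex^'n^'n) \<Rightarrow> (complex \<Rightarrow> complex^'n^'n) \<Rightarrow> bool" where
  "flat_frame B D \<Phi> \<Psi> \<longleftrightarrow> (\<forall>z\<in>D. mat_deriv \<Phi> (B z ** \<Phi> z) z \<and> mat_deriv \<Psi> (- (\<Psi> z ** B z)) z \<and>
     \<Psi> z ** \<Phi> z = mat 1 \<and> \<Phi> z ** \<Psi> z = mat 1)"

lemma matrix_mult_minus_left: "(- X) ** Y = - (X ** Y)" for X :: "complex^'m^'n"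
  by (simp add: matrix_matrix_mult_def vec_eq_iff sum_negf)

text \<open>\<open>\<Phi>\<close> and \<open>\<Psi>\<close> are obtained independently, as solutions of \<open>\<Phi>' = B \<Phi>\<close> and \<open>\<Psi>' = - \<Psi> B\<close>; then \<open>\<Psi> \<Phi>\<close> has derivative \<open>0\<close>, so
  the two are inverse to each other on the whole disc.\<close>

lemma local_flat_frame:
  fixes B :: "complex \<Rightarrow> complex^'n^'n"
  assumes "open S" "z0 \<in> S" and hol: "\<And>i j. (\<lambda>z. B z $ i $ j) holomorphic_on S"
  shows "\<exists>r>0. ball z0 r \<subseteq> S \<and> (\<exists>\<Phi> \<Psi>. flat_frame B (ball z0 r) \<Phi> \<Psi>)"
proof -
  obtain r1 where r1: "r1 > 0" "ball z0 r1 \<subseteq> S"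
      "\<And>c. \<exists>y. y z0 = c \<and> (\<forall>z\<in>ball z0 r1. vec_deriv y (B z *v y z) z)"
    using local_linear_ode[OF assms] by blast
  have "\<exists>r>0. ball z0 r \<subseteq> S \<and> (\<forall>c. \<exists>y. y z0 = c \<and>
      (\<forall>z\<in>ball z0 r. vec_deriv y ((\<chi> i j. - B z $ j $ i) *v y z) z))"
    by (rule local_linear_ode[OF assms(1,2)]) (auto intro!: holomorphic_intros hol)
  then obtain r2 where r2: "r2 > 0"
      "\<And>c. \<exists>y. y z0 = c \<and> (\<forall>z\<in>ball z0 r2. vec_deriv y ((\<chi> i j. - B z $ j $ i) *v y z) z)"
    by blast
  obtain \<phi> where \<phi>: "\<And>j::'n. \<phi> j z0 = axis j 1"
      "\<And>j z. z \<in> ball z0 r1 \<Longrightarrow> vec_deriv (\<phi> j) (B z *v \<phi> j z) z"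
    using r1(3)[of "axis _ 1"] by metis
  obtain \<psi> where \<psi>: "\<And>i::'n. \<psi> i z0 = axis i 1"
      "\<And>i z. z \<in> ball z0 r2 \<Longrightarrow> vec_deriv (\<psi> i) ((\<chi> i j. - B z $ j $ i) *v \<psi> i z) z"
    using r2(2)[of "axis _ 1"] by metis
  define \<Phi> where "\<Phi> = (\<lambda>z. \<chi> i j. \<phi> j z $ i)"
  define \<Psi> where "\<Psi> = (\<lambda>z. \<chi> i j. \<psi> i z $ j)"
  define r where "r = min r1 r2"
  have r: "0 < r" "ball z0 r \<subseteq> ball z0 r1" "ball z0 r \<subseteq> ball z0 r2"
    using r1(1) r2(1) by (auto simp: r_def)
  have d\<Phi>: "mat_deriv \<Phi> (B z ** \<Phi> z) z" if "z \<in> ball z0 r" for z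
    using \<phi>(2)[of z] r(2) that
    unfolding mat_deriv_def vec_deriv_def
    by (auto simp: \<Phi>_def matrix_vector_mult_def matrix_matrix_mult_def)
  have d\<Psi>: "mat_deriv \<Psi> (- (\<Psi> z ** B z)) z" if "z \<in> ball z0 r" for z
    unfolding mat_deriv_def
  proof (intro allI)
    fix i j
    have "((\<lambda>w. \<psi> i w $ j) has_field_derivative (((\<chi> i j. - B z $ j $ i) *v \<psi> i z) $ j)) (at z)"
      using \<psi>(2)[of z i] r(3) that unfolding vec_deriv_def by blast
    then show "((\<lambda>w. \<Psi> w $ i $ j) has_field_derivative (- (\<Psi> z ** B z)) $ i $ j) (at z)"
      by (simp add: \<Psi>_def matrix_vector_mult_def matrix_matrix_mult_def sum_negf mult.commute)
  qed
  have "flat_frame B (ball z0 r) \<Phi> \<Psi>"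
    unfolding flat_frame_def
  proof (intro ballI conjI d\<Phi> d\<Psi>)
    fix z assume z: "z \<in> ball z0 r"
    have "(\<Psi> z ** \<Phi> z) = (\<Psi> z0 ** \<Phi> z0)"
    proof (rule mat_deriv_zero_constant[OF convex_ball _ z])
      fix w assume w: "w \<in> ball z0 r"
      show "mat_deriv (\<lambda>w. \<Psi> w ** \<Phi> w) 0 w"
        using mat_deriv_mult[OF d\<Psi>[OF w] d\<Phi>[OF w]] by (simp add: matrix_mult_minus_left matrix_mul_assoc)
    qed (use r in simp)
    also have "\<Psi> z0 ** \<Phi> z0 = mat 1"
    proof -
      have "\<Psi> z0 = mat 1" "\<Phi> z0 = mat 1"
        by (auto simp: \<Psi>_def \<Phi>_def \<phi> \<psi> mat_def axis_def vec_eq_iff)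
      then show ?thesis by simp
    qed
    finally show "\<Psi> z ** \<Phi> z = mat 1" by simp
    then show "\<Phi> z ** \<Psi> z = mat 1" by (simp add: matrix_left_right_inverse)
  qed
  moreover have "ball z0 r \<subseteq> S" using r(2) r1(2) by blast
  ultimately show ?thesis using r(1) by blast
qed

text \<open>\<open>transport B S a M b\<close>: along some chain of convex open subsets of \<open>S\<close>, parallel
  transport from \<open>a\<close> to \<open>b\<close> is \<open>M\<close>. Endpoints with \<open>a = b\<close> give the monodromy group at \<open>a\<close>.\<close>

inductive transport :: "(complex \<Rightarrow> complex^'n^'n) \<Rightarrow> complex set \<Rightarrow> complex \<Rightarrow> complex^'n^'n \<Rightarrow> complex \<Rightarrow> bool"
  for B S a where
  start: "a \<in> S \<Longrightarrow> transport B S a (mat 1) a"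
| step: "transport B S a M b \<Longrightarrow> convex D \<Longrightarrow> open D \<Longrightarrow> D \<subseteq> S \<Longrightarrow> b \<in> D \<Longrightarrow> c \<in> D \<Longrightarrow>
    flat_frame B D \<Phi> \<Psi> \<Longrightarrow> transport B S a (\<Phi> c ** \<Psi> b ** M) c"

lemma transport_trans:
  assumes "transport B S b N c" "transport B S a M b"
  shows "transport B S a (N ** M) c"
  using assms
proof (induction rule: transport.induct)
  case (step N c D d \<Phi> \<Psi>)
  then have "transport B S a (\<Phi> d ** \<Psi> c ** (N ** M)) d"
    by (intro transport.step) auto
  then show ?case by (simp add: matrix_mul_assoc)
qed simp

lemma transport_step:
  assumes "convex D" "open D" "D \<subseteq> S" "b \<in> D" "c \<in> D" "flat_frame B D \<Phi> \<Psi>"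
  shows "transport B S b (\<Phi> c ** \<Psi> b) c"
proof -
  have "transport B S b (\<Phi> c ** \<Psi> b ** mat 1) c"
    using assms by (intro transport.step transport.start) auto
  then show ?thesis by simp
qed

lemma transport_inverse:
  assumes "transport B S a M b"
  shows "\<exists>N. transport B S b N a \<and> N ** M = mat 1 \<and> M ** N = mat 1"
  using assms
proof (induction rule: transport.induct)
  case start
  then show ?case by (intro exI[of _ "mat 1"]) (auto intro: transport.start)
next
  case (step M b D c \<Phi> \<Psi>)
  then obtain N where N: "transport B S b N a" "N ** M = mat 1" "M ** N = mat 1" by blast
  have bwd: "transport B S c (N ** (\<Phi> b ** \<Psi> c)) a"
    using transport_trans[OF N(1) transport_step] step.hyps by blast
  have i: "\<Psi> c ** \<Phi> c = mat 1" "\<Phi> b ** \<Psi> b = mat 1" "\<Phi> c ** \<Psi> c = mat 1" "\<Psi> b ** \<Phi> b = mat 1"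
    using step.hyps unfolding flat_frame_def by blast+
  have "N ** (\<Phi> b ** \<Psi> c) ** (\<Phi> c ** \<Psi> b ** M) = N ** (\<Phi> b ** ((\<Psi> c ** \<Phi> c) ** \<Psi> b)) ** M"
    by (simp add: matrix_mul_assoc)
  also have "\<dots> = mat 1" by (simp add: i N)
  finally have inv: "N ** (\<Phi> b ** \<Psi> c) ** (\<Phi> c ** \<Psi> b ** M) = mat 1" .
  then have "\<Phi> c ** \<Psi> b ** M ** (N ** (\<Phi> b ** \<Psi> c)) = mat 1"
    by (simp add: matrix_left_right_inverse)
  with bwd inv show ?case by blast
qed

lemma transport_exists:
  assumes "open S" "connected S" and hol: "\<And>i j. (\<lambda>z. B z $ i $ j) holomorphic_on S"
    and "a \<in> S" "b \<in> S"
  shows "\<exists>M. transport B S a M b"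
proof (rule connected_equivalence_relation[OF assms(2,4,5)])
  show "\<exists>M. transport B S y M x" if "\<exists>M. transport B S x M y" for x y
    using that transport_inverse by blast
  show "\<exists>M. transport B S x M z" if "\<exists>M. transport B S x M y" "\<exists>M. transport B S y M z" for x y z
    using that transport_trans by blast
  fix x assume x: "x \<in> S"
  obtain r \<Phi> \<Psi> where r: "r > 0" "ball x r \<subseteq> S" "flat_frame B (ball x r) \<Phi> \<Psi>"
    using local_flat_frame[OF assms(1) x hol] by blast
  have "\<exists>M. transport B S x M y" if "y \<in> ball x r" for y
    using transport_step[OF convex_ball open_ball r(2) _ that r(3), of x] r(1) by auto
  then show "\<exists>T. openin (top_of_set S) T \<and> x \<in> T \<and> (\<forall>y\<in>T. \<exists>M. transport B S x M y)"
    using r open_subset[OF r(2) open_ball] by (intro exI[of _ "ball x r"]) auto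
qed

text \<open>Conjugation by a transport from \<open>a\<close> to \<open>z\<close> carries \<open>P0\<close> to \<open>z\<close>. Two transports to \<open>z\<close> differ by an element of the
  monodromy group at \<open>a\<close>, which commutes with \<open>P0\<close>; so the result is single-valued. Locally it is
  \<open>\<Phi> K \<Psi>\<close> with a constant matrix \<open>K\<close>.\<close>

lemma parallel_endomorphism_exists:
  assumes S: "open S" "connected S" and hol: "\<And>i j. (\<lambda>z. B z $ i $ j) holomorphic_on S"
    and a: "a \<in> S" and comm: "\<And>M. transport B S a M a \<Longrightarrow> M ** P0 = P0 ** M"
  shows "\<exists>P. P a = P0 \<and> (\<forall>z\<in>S. mat_deriv P (B z ** P z - P z ** B z) z)"
proof -
  \<comment> \<open>\<open>T z M N\<close>: a transport \<open>M\<close> to \<open>z\<close> together with its inverse \<open>N\<close>, itself a transport back to \<open>a\<close>.\<close>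
  define T where "T = (\<lambda>z M N. transport B S a M z \<and> transport B S z N a \<and> N ** M = mat 1 \<and> M ** N = mat 1)"
  have T_ex: "\<exists>M N. T z M N" if "z \<in> S" for z
    using transport_exists[OF S hol a that] transport_inverse unfolding T_def by blast
  have T_unique: "M ** P0 ** N = M' ** P0 ** N'" if "T z M N" "T z M' N'" for z M N M' N'
  proof -
    have "(N ** M') ** P0 = P0 ** (N ** M')"
      using that transport_trans unfolding T_def by (intro comm) blast
    then have "M ** ((N ** M') ** P0) ** N' = M ** (P0 ** (N ** M')) ** N'" by simp
    then have "(M ** N) ** M' ** P0 ** N' = M ** P0 ** N ** (M' ** N')"
      by (simp only: matrix_mul_assoc)
    then show ?thesis using that by (simp add: T_def)
  qed
  define P where "P = (\<lambda>z. SOME X. \<exists>M N. T z M N \<and> X = M ** P0 ** N)"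
  have P: "P z = M ** P0 ** N" if "T z M N" for z M N
    unfolding P_def using that T_unique by (intro some_equality) blast+
  have "T a (mat 1) (mat 1)" using a by (simp add: T_def transport.start)
  then have "P a = P0" using P by fastforce
  moreover have "mat_deriv P (B z ** P z - P z ** B z) z" if z: "z \<in> S" for z
  proof -
    obtain r \<Phi> \<Psi> where r: "r > 0" "ball z r \<subseteq> S" and fr: "flat_frame B (ball z r) \<Phi> \<Psi>"
      using local_flat_frame[OF S(1) z hol] by blast
    obtain M N where MN: "T z M N" using T_ex[OF z] by blast
    define K where "K = \<Psi> z ** (M ** P0 ** N) ** \<Phi> z"
    have PK: "P w = \<Phi> w ** K ** \<Psi> w" if w: "w \<in> ball z r" for w
    proof -
      have zz: "z \<in> ball z r" using r by simp
      note i = fr[unfolded flat_frame_def, rule_format, OF w] fr[unfolded flat_frame_def, rule_format, OF zz]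
      have "T w (\<Phi> w ** \<Psi> z ** M) (N ** (\<Phi> z ** \<Psi> w))"
        unfolding T_def
      proof (intro conjI)
        show "transport B S a (\<Phi> w ** \<Psi> z ** M) w"
          using transport_trans[OF transport_step[OF convex_ball open_ball r(2) zz w fr]] MN by (simp add: T_def)
        show "transport B S w (N ** (\<Phi> z ** \<Psi> w)) a"
          using transport_trans[OF _ transport_step[OF convex_ball open_ball r(2) w zz fr]] MN by (simp add: T_def)
        have "N ** (\<Phi> z ** \<Psi> w) ** (\<Phi> w ** \<Psi> z ** M) = N ** (\<Phi> z ** ((\<Psi> w ** \<Phi> w) ** \<Psi> z)) ** M"
          by (simp add: matrix_mul_assoc)
        also have "\<dots> = mat 1" using i MN by (simp add: T_def)
        finally show "N ** (\<Phi> z ** \<Psi> w) ** (\<Phi> w ** \<Psi> z ** M) = mat 1" .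
        then show "\<Phi> w ** \<Psi> z ** M ** (N ** (\<Phi> z ** \<Psi> w)) = mat 1"
          by (simp add: matrix_left_right_inverse)
      qed
      from P[OF this] show ?thesis by (simp add: K_def matrix_mul_assoc)
    qed
    have zz: "z \<in> ball z r" using r by simp
    note f = fr[unfolded flat_frame_def, rule_format, OF zz]
    have "mat_deriv (\<lambda>w. \<Phi> w ** K ** \<Psi> w)
        ((B z ** \<Phi> z ** K + \<Phi> z ** 0) ** \<Psi> z + \<Phi> z ** K ** (- (\<Psi> z ** B z))) z"
      using f by (intro mat_deriv_mult mat_deriv_const) auto
    also have "(B z ** \<Phi> z ** K + \<Phi> z ** 0) ** \<Psi> z + \<Phi> z ** K ** (- (\<Psi> z ** B z)) = B z ** P z - P z ** B z"
    proof -
      have neg: "X ** (- Y) = - (X ** Y)" for X Y :: "complex^'a^'a"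
        by (simp add: matrix_matrix_mult_def vec_eq_iff sum_negf)
      show ?thesis unfolding PK[OF zz] neg by (simp add: matrix_mul_assoc)
    qed
    finally have d: "mat_deriv (\<lambda>w. \<Phi> w ** K ** \<Psi> w) (B z ** P z - P z ** B z) z" .
    show ?thesis
      unfolding mat_deriv_def
    proof (intro allI)
      fix i j
      show "((\<lambda>w. P w $ i $ j) has_field_derivative (B z ** P z - P z ** B z) $ i $ j) (at z)"
        using d[unfolded mat_deriv_def, rule_format, of i j]
        by (rule has_field_derivative_transform_within_open[OF _ open_ball zz]) (simp add: PK)
    qed
  qed
  ultimately show ?thesis by blast
qed

section \<open>Endomorphisms commuting with the monodromy\<close>

lemma vec_linearI:
  fixes f :: "complex^'n \<Rightarrow> complex^'m"
  assumes "\<And>x y. f (x + y) = f x + f y" "\<And>c x. f (c *s x) = c *s f x"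
  shows "Vector_Spaces.linear (*s) (*s) f"
  using assms by unfold_locales (simp_all add: vec_eq_iff algebra_simps)

text \<open>The matrix of the connection restricted to a line that meets the \<open>H\<close>-th hyperplane at \<open>t H\<close>, in the direction of the
  coordinate \<open>z\<close>.\<close>

definition line_connection :: "'i set \<Rightarrow> ('i \<Rightarrow> complex^'n^'n) \<Rightarrow> ('i \<Rightarrow> complex) \<Rightarrow> complex \<Rightarrow> complex^'n^'n" where
  "line_connection I A t z = (\<chi> i j. \<Sum>H\<in>I. A H $ i $ j / (z - t H))"

lemma line_connection_mult_vec:
  "line_connection I A t z *v w = (\<Sum>H\<in>I. (1 / (z - t H)) *s (A H *v w))"
proof -
  have "(\<Sum>j\<in>UNIV. (\<Sum>H\<in>I. A H $ i $ j / (z - t H)) * w $ j) = (\<Sum>H\<in>I. \<Sum>j\<in>UNIV. A H $ i $ j / (z - t H) * w $ j)" for i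
    unfolding sum_distrib_right by (rule sum.swap)
  then show ?thesis
    by (simp add: line_connection_def matrix_vector_mult_def vec_eq_iff sum_distrib_left sum_divide_distrib)
qed

lemma line_connection_holomorphic:
  assumes "finite I"
  shows "(\<lambda>z. line_connection I A t z $ i $ j) holomorphic_on (UNIV - t ` I)"
  unfolding line_connection_def by (auto intro!: holomorphic_intros)

text \<open>The only possible non-zero eigenvalues of \<open>ad A\<close>, for \<open>A w = f w *s n\<close>, are \<open>f n\<close> and \<open>- f n\<close>: apply the equation to \<open>n\<close>, then
  apply \<open>f\<close> to it.\<close>

lemma ad_rank_one_nonresonant:
  fixes X :: "complex^'n^'n"
  assumes lin: "Vector_Spaces.linear (*s) (*) f" and A: "\<And>w. A *v w = f w *s n"
    and \<kappa>: "\<kappa> \<noteq> 0" "f n \<noteq> \<kappa>" "f n \<noteq> - \<kappa>"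
    and eq: "\<And>w. A *v (X *v w) - X *v (A *v w) = - \<kappa> *s (X *v w)"
  shows "X = 0"
proof -
  have e: "f (X *v w) *s n - f w *s (X *v n) = - \<kappa> *s (X *v w)" for w
    using eq[of w] by (simp add: A vector_scalar_commute)
  have fe: "f (X *v w) * f n - f w * f (X *v n) = - \<kappa> * f (X *v w)" for w
    using arg_cong[OF e[of w], of f] by (simp only: form_diff[OF lin] form_scale[OF lin])
  have "\<kappa> * f (X *v n) = 0" using fe[of n] by (simp add: mult.commute)
  then have fXn: "f (X *v n) = 0" using \<kappa> by simp
  then have "(f n - \<kappa>) *s (X *v n) = 0" using e[of n] by (simp add: vector_sub_rdistrib)
  then have Xn: "X *v n = 0" using \<kappa> by (simp add: vec.scale_eq_0_iff)
  have "X *v w = 0" for w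
  proof -
    have "(f n + \<kappa>) * f (X *v w) = 0" using fe[of w] by (simp add: fXn algebra_simps)
    moreover have "f n + \<kappa> \<noteq> 0" using \<kappa>(3) by (simp add: add_eq_0_iff2)
    ultimately have "f (X *v w) = 0" by simp
    then have "\<kappa> *s (X *v w) = 0" using e[of w] by (simp add: Xn)
    then show ?thesis using \<kappa> by (simp add: vec.scale_eq_0_iff)
  qed
  then show ?thesis by (simp add: matrix_eq)
qed

text \<open>Endomorphisms are turned into vectors so that the adjoint system \<open>P' = [B, P]\<close> becomes a Fuchsian system for a
  vector-valued function.\<close>

definition flatten :: "complex^'n^'n \<Rightarrow> complex^('n \<times> 'n)" where
  "flatten P = (\<chi> k. P $ fst k $ snd k)"

definition unflatten :: "complex^('n \<times> 'n) \<Rightarrow> complex^'n^'n" where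
  "unflatten x = (\<chi> i j. x $ (i, j))"

lemma flatten_nth: "flatten P $ k = P $ fst k $ snd k"
  by (simp add: flatten_def)

lemma unflatten_flatten [simp]: "unflatten (flatten P) = P"
  by (simp add: flatten_def unflatten_def vec_eq_iff)

lemma flatten_unflatten [simp]: "flatten (unflatten x) = x"
  by (simp add: flatten_def unflatten_def vec_eq_iff)

lemma commutator_linear:
  "Vector_Spaces.linear (*s) (*s) (\<lambda>x. flatten (A ** unflatten x - unflatten x ** A))"
  by (rule vec_linearI)
    (simp_all add: flatten_def unflatten_def matrix_matrix_mult_def vec_eq_iff algebra_simps sum.distrib sum_distrib_left)

lemma flatten_sum: "(\<Sum>i\<in>I. flatten (F i)) = flatten (\<Sum>i\<in>I. F i)"
  by (simp add: flatten_def vec_eq_iff)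

text \<open>An endomorphism commuting with the monodromy extends to a single-valued solution of the adjoint system.
  Non-integral traces exclude resonance at the finite singular points, and centrality of the sum of the
  residues excludes it at infinity. So the solution is constant, and its derivative \<open>\<Sum> [A H, P0] / (z - t H)\<close>
  vanishes.\<close>

lemma monodromy_commutant_commutes_with_residues:
  fixes A :: "'i \<Rightarrow> complex^'n^'n" and t :: "'i \<Rightarrow> complex" and l :: "'i \<Rightarrow> complex^'n \<Rightarrow> complex"
  assumes fin: "finite I" and inj: "inj_on t I" and a: "a \<notin> t ` I"
    and lin: "\<And>H. H \<in> I \<Longrightarrow> Vector_Spaces.linear (*s) (*) (l H)"
    and n: "\<And>H w. H \<in> I \<Longrightarrow> A H *v w = l H w *s n H"
    and nonint: "\<And>H. H \<in> I \<Longrightarrow> l H (n H) \<notin> \<int>"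
    and central: "\<And>X. (\<Sum>H\<in>I. A H) ** X = X ** (\<Sum>H\<in>I. A H)"
    and mono: "\<And>M. transport (line_connection I A t) (UNIV - t ` I) a M a \<Longrightarrow> M ** P0 = P0 ** M"
    and H: "H \<in> I"
  shows "P0 ** A H = A H ** P0"
proof -
  define B where "B = line_connection I A t"
  define S where "S = UNIV - t ` I"
  have S: "open S" "connected S"
    unfolding S_def using fin
    by (auto intro!: open_Diff finite_imp_closed connected_open_delete_finite)
  have Sa: "a \<in> S" using a by (simp add: S_def)
  have hol: "(\<lambda>z. B z $ i $ j) holomorphic_on S" for i j
    unfolding B_def S_def by (rule line_connection_holomorphic[OF fin])
  obtain P where P: "P a = P0" "\<And>z. z \<in> S \<Longrightarrow> mat_deriv P (B z ** P z - P z ** B z) z"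
    using parallel_endomorphism_exists[OF S hol Sa mono[folded B_def S_def]] by blast
  define L where "L = (\<lambda>H x. flatten (A H ** unflatten x - unflatten x ** A H))"
  have Bmult: "B z ** X - X ** B z = (\<chi> i j. \<Sum>H\<in>I. (A H ** X - X ** A H) $ i $ j / (z - t H))" for z X
  proof -
    have 1: "(\<Sum>k\<in>UNIV. (\<Sum>H\<in>I. A H $ i $ k / (z - t H)) * X $ k $ j) = (\<Sum>H\<in>I. (\<Sum>k\<in>UNIV. A H $ i $ k * X $ k $ j) / (z - t H))" for i j
      unfolding sum_distrib_right sum_divide_distrib by (subst sum.swap) (simp add: mult.commute)
    have 2: "(\<Sum>k\<in>UNIV. X $ i $ k * (\<Sum>H\<in>I. A H $ k $ j / (z - t H))) = (\<Sum>H\<in>I. (\<Sum>k\<in>UNIV. X $ i $ k * A H $ k $ j) / (z - t H))" for i j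
      unfolding sum_distrib_left sum_divide_distrib by (subst sum.swap) simp
    show ?thesis
      unfolding B_def line_connection_def
      by (simp add: matrix_matrix_mult_def vec_eq_iff 1 2 diff_divide_distrib sum_subtractf)
  qed
  define f where "f = (\<lambda>z. flatten (P z))"
  have f_deriv: "vec_deriv f (\<Sum>H\<in>I. (1 / (z - t H)) *s L H (f z)) z" if "z \<notin> t ` I" for z
    using P(2)[of z] that unfolding Bmult S_def mat_deriv_def vec_deriv_def
    by (simp add: f_def L_def flatten_nth)
  have "\<exists>x. \<forall>z. z \<notin> t ` I \<longrightarrow> f z = x"
  proof (rule nonresonant_fuchsian_constant[OF fin inj, of L])
    show "Vector_Spaces.linear (*s) (*s) (L H)" for H
      unfolding L_def by (rule commutator_linear)
    show "vec_deriv f (\<Sum>H\<in>I. (1 / (z - t H)) *s L H (f z)) z" if "z \<notin> t ` I" for z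
      by (rule f_deriv[OF that])
    show "x = 0" if H: "H \<in> I" and "L H x = - of_nat (Suc k) *s x" for H k x
    proof -
      let ?X = "unflatten x"
      have "unflatten (L H x) = unflatten (- of_nat (Suc k) *s x)" using that(2) by simp
      then have m: "A H ** ?X - ?X ** A H = (\<chi> i j. - of_nat (Suc k) * ?X $ i $ j)"
        unfolding L_def unflatten_flatten by (simp add: unflatten_def vec_eq_iff del: of_nat_Suc)
      have "?X = 0"
      proof (rule ad_rank_one_nonresonant[OF lin[OF H] n[OF H]])
        show "of_nat (Suc k) \<noteq> (0::complex)" by (simp del: of_nat_Suc)
        show "l H (n H) \<noteq> of_nat (Suc k)" using nonint[OF H] by (metis Ints_of_nat)
        show "l H (n H) \<noteq> - of_nat (Suc k)" using nonint[OF H] by (metis Ints_of_nat Ints_minus)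
        fix w
        have "A H *v (?X *v w) - ?X *v (A H *v w) = (A H ** ?X - ?X ** A H) *v w"
          by (simp add: matrix_vector_mul_assoc matrix_vector_mult_diff_rdistrib)
        also have "\<dots> = - of_nat (Suc k) *s (?X *v w)"
          unfolding m by (simp add: matrix_vector_mult_def vec_eq_iff sum_distrib_left mult.assoc sum_negf del: of_nat_Suc)
        finally show "A H *v (?X *v w) - ?X *v (A H *v w) = - of_nat (Suc k) *s (?X *v w)" .
      qed
      then have "flatten ?X = 0" by (simp add: flatten_def vec_eq_iff)
      then show "x = 0" by simp
    qed
    show "x = 0" if "(\<Sum>H\<in>I. L H x) = of_nat (Suc k) *s x" for k x
    proof -
      let ?X = "unflatten x"
      have "(\<Sum>H\<in>I. A H ** ?X - ?X ** A H) = (\<Sum>H\<in>I. A H) ** ?X - ?X ** (\<Sum>H\<in>I. A H)"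
      proof -
        have "(\<Sum>H\<in>F. A H ** ?X - ?X ** A H) = (\<Sum>H\<in>F. A H) ** ?X - ?X ** (\<Sum>H\<in>F. A H)" for F
        proof (induction F rule: infinite_finite_induct)
          case (insert H F)
          have "(Y + Z) ** X = Y ** X + Z ** X" for X Y Z :: "complex^'n^'n"
            by (simp add: matrix_matrix_mult_def vec_eq_iff distrib_right sum.distrib)
          then show ?case using insert by (simp add: matrix_add_ldistrib)
        qed simp_all
        then show ?thesis by blast
      qed
      also have "\<dots> = 0" by (simp add: central)
      finally have "(\<Sum>H\<in>I. L H x) = 0"
        unfolding L_def flatten_sum by (simp add: flatten_def vec_eq_iff)
      then show "x = 0" using that by (simp add: vec.scale_eq_0_iff del: of_nat_Suc)
    qed
  qed
  then obtain x0 where x0: "\<And>z. z \<in> S \<Longrightarrow> f z = x0" unfolding S_def by blast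
  have x0P: "x0 = flatten P0" using x0[OF Sa] P(1) by (simp add: f_def)
  have "L H x0 $ k = 0" for k
  proof (rule partial_fractions_zero[OF fin inj _ H])
    fix z assume z: "z \<notin> t ` I"
    have "((\<lambda>w. f w $ k) has_field_derivative (\<Sum>H\<in>I. (1 / (z - t H)) *s L H (f z)) $ k) (at z)"
      using f_deriv[OF z] unfolding vec_deriv_def by blast
    moreover have "((\<lambda>w. f w $ k) has_field_derivative 0) (at z)"
    proof (rule has_field_derivative_transform_within_open[OF _ S(1)])
      show "((\<lambda>w. x0 $ k) has_field_derivative 0) (at z)" by simp
    qed (use z x0 in \<open>auto simp: S_def\<close>)
    ultimately have "(\<Sum>H\<in>I. (1 / (z - t H)) *s L H (f z)) $ k = 0" by (rule DERIV_unique)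
    then show "(\<Sum>H\<in>I. L H x0 $ k / (z - t H)) = 0" using x0[of z] z by (simp add: S_def)
  qed
  then have "unflatten (L H x0) = 0" by (simp add: unflatten_def vec_eq_iff)
  then show ?thesis by (simp add: L_def x0P)
qed

section \<open>Hermitian inner products\<close>

lemma hermitian_inner_product_simps:
  assumes "hermitian_inner_product b"
  shows "b (x + y) w = b x w + b y w" "b (x - y) w = b x w - b y w" "b (c *s x) w = c * b x w" "b 0 w = 0"
    "b w (x + y) = b w x + b w y" "b w (c *s x) = cnj c * b w x" "b w 0 = 0"
proof -
  have l: "Vector_Spaces.linear (*s) (*) (\<lambda>u. b u w)" for w
    using assms unfolding hermitian_inner_product_def by blast
  have c: "b w u = cnj (b u w)" for u w using assms unfolding hermitian_inner_product_def by blast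
  show 1: "b (x + y) w = b x w + b y w" for w x y by (rule form_add[OF l])
  show "b (x - y) w = b x w - b y w" by (rule form_diff[OF l])
  show 2: "b (c *s x) w = c * b x w" for w x c by (rule form_scale[OF l])
  show 3: "b 0 w = 0" for w by (rule form_zero[OF l])
  show "b w (x + y) = b w x + b w y" using 1[of x y w] c by (metis complex_cnj_add)
  show "b w (c *s x) = cnj c * b w x" using 2[of c x w] c by (metis complex_cnj_mult)
  show "b w 0 = 0" using 3[of w] c by (metis complex_cnj_zero)
qed

lemma hermitian_expand:
  assumes b: "hermitian_inner_product b"
  shows "b u w = (\<Sum>i\<in>UNIV. \<Sum>j\<in>UNIV. u $ i * cnj (w $ j) * b (axis i 1) (axis j 1))"
proof -
  have s1: "b (\<Sum>i\<in>I. x i) w = (\<Sum>i\<in>I. b (x i) w)" for I x w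
    by (induction I rule: infinite_finite_induct) (simp_all add: hermitian_inner_product_simps[OF b])
  have s2: "b w (\<Sum>i\<in>I. x i) = (\<Sum>i\<in>I. b w (x i))" for I x w
    by (induction I rule: infinite_finite_induct) (simp_all add: hermitian_inner_product_simps[OF b])
  have "b u w = b (\<Sum>i\<in>UNIV. u $ i *s axis i 1) (\<Sum>j\<in>UNIV. w $ j *s axis j 1)"
    by (simp only: basis_expansion)
  also have "\<dots> = (\<Sum>i\<in>UNIV. \<Sum>j\<in>UNIV. u $ i * cnj (w $ j) * b (axis i 1) (axis j 1))"
    unfolding s1 unfolding s2 by (simp only: hermitian_inner_product_simps[OF b] mult_ac)
  finally show ?thesis .
qed

text \<open>Gram--Schmidt, one vector of \<open>E\<close> at a time.\<close>

lemma orthogonal_projection_finite: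
  fixes b :: "complex^'n \<Rightarrow> complex^'n \<Rightarrow> complex"
  assumes b: "hermitian_inner_product b" and "finite E"
  shows "\<exists>P. Vector_Spaces.linear (*s) (*s) P \<and> (\<forall>x. P x \<in> vec.span E) \<and>
    (\<forall>x. \<forall>w\<in>vec.span E. b (x - P x) w = 0)"
  using \<open>finite E\<close>
proof induction
  case empty
  show ?case
  proof (intro exI[of _ "\<lambda>x. 0"] conjI allI ballI)
    show "Vector_Spaces.linear (*s) (*s) (\<lambda>x::complex^'n. 0::complex^'n)" by (rule vec_linearI) simp_all
  qed (simp_all add: hermitian_inner_product_simps[OF b] vec.span_zero)
next
  case (insert e E)
  note bs = hermitian_inner_product_simps[OF b]
  have csym: "b v u = cnj (b u v)" for u v using b unfolding hermitian_inner_product_def by blast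
  obtain P where P: "Vector_Spaces.linear (*s) (*s) P" "\<And>x. P x \<in> vec.span E"
      "\<And>x w. w \<in> vec.span E \<Longrightarrow> b (x - P x) w = 0"
    using insert.IH by blast
  define e' where "e' = e - P e"
  have e'E: "b e' w = 0" "b w e' = 0" if "w \<in> vec.span E" for w
  proof -
    show 1: "b e' w = 0" unfolding e'_def by (rule P(3)[OF that])
    show "b w e' = 0" unfolding csym[of w e'] 1 by simp
  qed
  define Q where "Q = (\<lambda>x. P x + (b x e' / b e' e') *s e')"
  have pos: "b e' e' \<noteq> 0" if "e' \<noteq> 0"
  proof -
    have "0 < Re (b e' e')" using b that unfolding hermitian_inner_product_def by blast
    then show ?thesis by auto
  qed
  have spanE: "vec.span E \<subseteq> vec.span (insert e E)" by (rule vec.span_mono) auto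
  have e'span: "e' \<in> vec.span (insert e E)"
    unfolding e'_def using vec.span_diff[OF vec.span_base subsetD[OF spanE P(2)[of e]]] by blast
  have "Vector_Spaces.linear (*s) (*s) Q"
    unfolding Q_def
    by (rule vec_linearI)
      (simp_all add: vec.linear_add[OF P(1)] vec.linear_scale[OF P(1)] bs add_divide_distrib
        vec_eq_iff distrib_right distrib_left)
  moreover have "Q x \<in> vec.span (insert e E)" for x
    unfolding Q_def using P(2)[of x] spanE e'span by (intro vec.span_add vec.span_scale) auto
  moreover have "b (x - Q x) w = 0" if wE: "w \<in> vec.span (insert e E)" for x w
  proof -
    obtain k where k: "w - k *s e \<in> vec.span E"
      using vec.span_breakdown_eq[THEN iffD1, OF wE] by blast
    \<comment> \<open>Replace the new vector \<open>e\<close> by its component \<open>e'\<close> orthogonal to the span of \<open>E\<close>.\<close>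
    define w' where "w' = (w - k *s e) + k *s P e"
    have w': "w' \<in> vec.span E" unfolding w'_def using k P(2) by (intro vec.span_add vec.span_scale) auto
    have w: "w = w' + k *s e'" by (simp add: w'_def e'_def vec.scale_right_diff_distrib)
    have 1: "b (x - Q x) w' = 0"
    proof -
      have "b (x - Q x) w' = b (x - P x) w' - (b x e' / b e' e') * b e' w'"
        by (simp add: Q_def bs)
      then show ?thesis using P(3)[OF w'] e'E[OF w'] by simp
    qed
    have 2: "b (x - Q x) e' = 0"
    proof (cases "e' = 0")
      case False
      have "b (x - Q x) e' = b x e' - b (P x) e' - (b x e' / b e' e') * b e' e'"
        by (simp add: Q_def bs)
      then show ?thesis using pos[OF False] e'E[OF P(2)[of x]] by simp
    qed (simp add: bs)
    show ?thesis unfolding w bs(5,6) 1 2 by simp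
  qed
  ultimately show ?case by blast
qed

lemma orthogonal_projection:
  fixes b :: "complex^'n \<Rightarrow> complex^'n \<Rightarrow> complex"
  assumes b: "hermitian_inner_product b" and W: "vec.subspace W"
  obtains P :: "complex^'n^'n" where "\<And>x. P *v x \<in> W" "\<And>x. x \<in> W \<Longrightarrow> P *v x = x"
    "\<And>x. (\<And>w. w \<in> W \<Longrightarrow> b x w = 0) \<Longrightarrow> P *v x = 0"
    "\<And>x w. w \<in> W \<Longrightarrow> b (x - P *v x) w = 0"
proof -
  note bs = hermitian_inner_product_simps[OF b]
  have csym: "b v u = cnj (b u v)" for u v using b unfolding hermitian_inner_product_def by blast
  have zero: "x = 0" if "b x x = 0" for x
  proof (rule ccontr)
    assume "x \<noteq> 0"
    then have "0 < Re (b x x)" using b unfolding hermitian_inner_product_def by blast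
    then show False using that by simp
  qed
  obtain E where E: "E \<subseteq> W" "vec.independent E" "W \<subseteq> vec.span E"
    using vec.basis_exists[of W] by metis
  have WE: "vec.span E = W" using E W by (metis vec.span_minimal subset_antisym)
  have "finite E" using E(2) by (rule vec.finiteI_independent)
  then obtain f where f: "Vector_Spaces.linear (*s) (*s) f" "\<And>x. f x \<in> W"
      "\<And>x w. w \<in> W \<Longrightarrow> b (x - f x) w = 0"
    using orthogonal_projection_finite[OF b] unfolding WE[symmetric] by metis
  have mf: "matrix f *v x = f x" for x by (rule matrix_works[OF f(1)])
  show ?thesis
  proof
    show "matrix f *v x \<in> W" for x unfolding mf by (rule f(2))
    show "b (x - matrix f *v x) w = 0" if "w \<in> W" for x w unfolding mf by (rule f(3)[OF that])
    show "matrix f *v x = x" if "x \<in> W" for x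
    proof -
      have "b (x - f x) (x - f x) = 0" using that W f(2)[of x] by (intro f(3) vec.subspace_diff) auto
      then show ?thesis using zero mf by fastforce
    qed
    show "matrix f *v x = 0" if "\<And>w. w \<in> W \<Longrightarrow> b x w = 0" for x
    proof -
      have "b (f x) (f x) = b x (f x) - b (x - f x) (f x)" by (simp add: bs)
      also have "\<dots> = 0" using that[OF f(2)] f(3)[OF f(2)] by simp
      finally show ?thesis using zero mf by simp
    qed
  qed
qed

section \<open>Parallel transport along a generic line\<close>

lemma mat_deriv_vec:
  fixes F :: "complex \<Rightarrow> complex^'m^'n"
  assumes "mat_deriv F F' z"
  shows "vec_deriv (\<lambda>w. F w *v u) (F' *v u) z"
  unfolding vec_deriv_def matrix_vector_mult_def vec_lambda_beta
proof (intro allI DERIV_sum DERIV_cmult_right)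
  show "((\<lambda>w. F w $ i $ j) has_field_derivative F' $ i $ j) (at z)" for i j
    using assms unfolding mat_deriv_def by blast
qed


lemma joinpaths_has_vector_derivative_left:
  assumes "(f has_vector_derivative f') (at (2 * x))" "x < 1/2"
  shows "((f +++ g) has_vector_derivative 2 *\<^sub>R f') (at x)"
proof (rule has_vector_derivative_transform_within_open)
  have "((*) 2 has_vector_derivative 2) (at x)"
    by (simp add: has_vector_derivative_def has_derivative_def bounded_linear_mult_left)
  from vector_diff_chain_at[OF this assms(1)]
  show "((\<lambda>x. f (2 * x)) has_vector_derivative 2 *\<^sub>R f') (at x)" by (simp add: o_def)
  show "open {..<1/2::real}" "x \<in> {..<1/2}" using assms by auto
qed (auto simp: joinpaths_def)

lemma joinpaths_has_vector_derivative_right: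
  assumes "(g has_vector_derivative g') (at (2 * x - 1))" "1/2 < x"
  shows "((f +++ g) has_vector_derivative 2 *\<^sub>R g') (at x)"
proof (rule has_vector_derivative_transform_within_open)
  have "((\<lambda>x. 2 * x - 1) has_vector_derivative 2) (at x)"
    by (simp add: has_vector_derivative_def has_derivative_def bounded_linear_mult_left)
  from vector_diff_chain_at[OF this assms(1)]
  show "((\<lambda>x. g (2 * x - 1)) has_vector_derivative 2 *\<^sub>R g') (at x)" by (simp add: o_def)
  show "open {1/2::real<..}" "x \<in> {1/2<..}" using assms by auto
qed (auto simp: joinpaths_def)

context
  fixes \<H> :: "(complex^'n) set set"
    and h :: "(complex^'n) set \<Rightarrow> complex^'n \<Rightarrow> complex"
    and A :: "(complex^'n) set \<Rightarrow> complex^'n^'n"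
  assumes arr: "arrangement \<H> h"
begin

lemma conn_form_scaleR: "conn_form \<H> h A x (c *\<^sub>R v) w = c *\<^sub>R conn_form \<H> h A x v w"
  unfolding conn_form_def scaleR_right.sum
  by (intro sum.cong refl)
    (simp add: scaleR_vec_eq form_scale[OF equation_linear[OF arr]] vector_smult_assoc)

text \<open>The corner \<open>1/2\<close> joins the exceptional parameters of the two pieces; both velocities double, and so do both
  sides of the parallel transport equation.\<close>

lemma parallel_along_join:
  assumes s1: "parallel_along \<H> h A \<gamma>1 s1" and s2: "parallel_along \<H> h A \<gamma>2 s2" and "s1 1 = s2 0"
  shows "parallel_along \<H> h A (\<gamma>1 +++ \<gamma>2) (s1 +++ s2)"
proof -
  obtain S1 where S1: "finite S1" "\<And>t. t \<in> {0..1} - S1 \<Longrightarrow> \<gamma>1 differentiable (at t) \<and>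
      (s1 has_vector_derivative conn_form \<H> h A (\<gamma>1 t) (vector_derivative \<gamma>1 (at t)) (s1 t)) (at t)"
    using s1 unfolding parallel_along_def by blast
  obtain S2 where S2: "finite S2" "\<And>t. t \<in> {0..1} - S2 \<Longrightarrow> \<gamma>2 differentiable (at t) \<and>
      (s2 has_vector_derivative conn_form \<H> h A (\<gamma>2 t) (vector_derivative \<gamma>2 (at t)) (s2 t)) (at t)"
    using s2 unfolding parallel_along_def by blast
  define S where "S = insert (1/2) ((\<lambda>x. 2 * x) -` S1 \<union> (\<lambda>x. 2 * x - 1) -` S2)"
  have "finite S"
    unfolding S_def using S1(1) S2(1) by (auto intro!: finite_vimageI inj_onI)
  moreover have "(\<gamma>1 +++ \<gamma>2) differentiable (at t) \<and>
      ((s1 +++ s2) has_vector_derivative conn_form \<H> h A ((\<gamma>1 +++ \<gamma>2) t) (vector_derivative (\<gamma>1 +++ \<gamma>2) (at t)) ((s1 +++ s2) t)) (at t)"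
    if t: "t \<in> {0..1} - S" for t
  proof (cases "t < 1/2")
    case True
    then have t1: "2 * t \<in> {0..1} - S1" using t by (auto simp: S_def)
    have "(\<gamma>1 has_vector_derivative vector_derivative \<gamma>1 (at (2 * t))) (at (2 * t))"
      using S1(2)[OF t1] vector_derivative_works by blast
    note d = joinpaths_has_vector_derivative_left[OF this True, of \<gamma>2]
    have "((s1 +++ s2) has_vector_derivative 2 *\<^sub>R conn_form \<H> h A (\<gamma>1 (2 * t)) (vector_derivative \<gamma>1 (at (2 * t))) (s1 (2 * t))) (at t)"
      using S1(2)[OF t1] joinpaths_has_vector_derivative_left True by blast
    moreover have "(\<gamma>1 +++ \<gamma>2) t = \<gamma>1 (2 * t)" "(s1 +++ s2) t = s1 (2 * t)"
      using True by (simp_all add: joinpaths_def)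
    ultimately show ?thesis
      unfolding vector_derivative_at[OF d] conn_form_scaleR using differentiableI_vector[OF d] by simp
  next
    case False
    then have gt: "1/2 < t" using t by (auto simp: S_def)
    then have t2: "2 * t - 1 \<in> {0..1} - S2" using t by (auto simp: S_def)
    have "(\<gamma>2 has_vector_derivative vector_derivative \<gamma>2 (at (2 * t - 1))) (at (2 * t - 1))"
      using S2(2)[OF t2] vector_derivative_works by blast
    note d = joinpaths_has_vector_derivative_right[OF this gt, of \<gamma>1]
    have "((s1 +++ s2) has_vector_derivative 2 *\<^sub>R conn_form \<H> h A (\<gamma>2 (2 * t - 1)) (vector_derivative \<gamma>2 (at (2 * t - 1))) (s2 (2 * t - 1))) (at t)"
      using S2(2)[OF t2] joinpaths_has_vector_derivative_right gt by blast
    moreover have "(\<gamma>1 +++ \<gamma>2) t = \<gamma>2 (2 * t - 1)" "(s1 +++ s2) t = s2 (2 * t - 1)"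
      using gt by (simp_all add: joinpaths_def)
    ultimately show ?thesis
      unfolding vector_derivative_at[OF d] conn_form_scaleR using differentiableI_vector[OF d] by simp
  qed
  moreover have "continuous_on {0..1} (s1 +++ s2)"
    using s1 s2 \<open>s1 1 = s2 0\<close> unfolding parallel_along_def
    by (intro continuous_on_joinpaths) (auto simp: pathfinish_def pathstart_def)
  ultimately show ?thesis unfolding parallel_along_def by blast
qed

context
  fixes p v :: "complex^'n" and t :: "(complex^'n) set \<Rightarrow> complex"
  assumes v: "\<And>H. H \<in> \<H> \<Longrightarrow> h H v \<noteq> 0"
    and line: "\<And>H z. H \<in> \<H> \<Longrightarrow> h H (p + z *s v) = h H v * (z - t H)"
begin

lemma line_in_complement: "p + z *s v \<in> complement \<H> \<longleftrightarrow> z \<in> UNIV - t ` \<H>"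
  using v line by (auto simp: mem_complement[OF arr])

lemma conn_form_line:
  "conn_form \<H> h A (p + z *s v) (c *s v) w = c *s (line_connection \<H> A t z *v w)"
  unfolding conn_form_def line_connection_mult_vec vec.scale_sum_right
  by (intro sum.cong refl)
    (simp add: line form_scale[OF equation_linear[OF arr]] vector_smult_assoc v)

lemma transport_segment_parallel:
  assumes D: "convex D" "b \<in> D" "c \<in> D" and fr: "flat_frame (line_connection \<H> A t) D \<Phi> \<Psi>"
  shows "\<exists>s. parallel_along \<H> h A (linepath (p + b *s v) (p + c *s v)) s \<and> s 0 = u \<and> s 1 = (\<Phi> c ** \<Psi> b) *v u"
proof -
  define s where "s = (\<lambda>\<tau>. \<Phi> (b + of_real \<tau> * (c - b)) *v (\<Psi> b *v u))"
  have pt: "linepath (p + b *s v) (p + c *s v) \<tau> = p + (b + of_real \<tau> * (c - b)) *s v" for \<tau>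
    unfolding linepath_def scaleR_vec_eq by (simp add: vec_eq_iff algebra_simps)
  have dir: "p + c *s v - (p + b *s v) = (c - b) *s v" by (simp add: vec_eq_iff algebra_simps)
  have inD: "b + of_real \<tau> * (c - b) \<in> D" if "\<tau> \<in> {0..1}" for \<tau>
  proof -
    have "(1 - \<tau>) *\<^sub>R b + \<tau> *\<^sub>R c \<in> D" using D that by (intro convexD) auto
    moreover have "(1 - \<tau>) *\<^sub>R b + \<tau> *\<^sub>R c = b + of_real \<tau> * (c - b)"
      by (simp add: scaleR_conv_of_real algebra_simps)
    ultimately show ?thesis by simp
  qed
  have d: "(s has_vector_derivative conn_form \<H> h A (linepath (p + b *s v) (p + c *s v) \<tau>)
      (vector_derivative (linepath (p + b *s v) (p + c *s v)) (at \<tau>)) (s \<tau>)) (at \<tau>)"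
    if \<tau>: "\<tau> \<in> {0..1}" for \<tau>
  proof -
    let ?z = "b + of_real \<tau> * (c - b)"
    have "mat_deriv \<Phi> (line_connection \<H> A t ?z ** \<Phi> ?z) ?z"
      using fr inD[OF \<tau>] unfolding flat_frame_def by blast
    from vec_deriv_along_line[OF mat_deriv_vec[OF this, of "\<Psi> b *v u"]]
    show ?thesis
      unfolding pt vector_derivative_linepath_at dir conn_form_line
      by (simp add: s_def matrix_vector_mul_assoc matrix_mul_assoc)
  qed
  have "continuous_on {0..1} s"
    by (rule continuous_at_imp_continuous_on) (use d has_vector_derivative_continuous in blast)
  then have "parallel_along \<H> h A (linepath (p + b *s v) (p + c *s v)) s"
    unfolding parallel_along_def using d differentiableI_vector[OF has_vector_derivative_linepath_within] by blast
  moreover have "s 0 = u" using fr D by (simp add: s_def flat_frame_def matrix_vector_mul_assoc)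
  moreover have "s 1 = (\<Phi> c ** \<Psi> b) *v u" by (simp add: s_def matrix_vector_mul_assoc)
  ultimately show ?thesis by blast
qed

text \<open>Each step of a transport becomes a segment inside a convex set, so the path is polygonal.\<close>

lemma transport_realised_by_path:
  assumes "transport (line_connection \<H> A t) (UNIV - t ` \<H>) a M b"
  shows "\<exists>\<gamma>. valid_path \<gamma> \<and> path_image \<gamma> \<subseteq> complement \<H> \<and> pathstart \<gamma> = p + a *s v \<and> pathfinish \<gamma> = p + b *s v \<and>
    (\<forall>u. \<exists>s. parallel_along \<H> h A \<gamma> s \<and> s 0 = u \<and> s 1 = M *v u)"
  using assms
proof (induction rule: transport.induct)
  case start
  have "parallel_along \<H> h A (linepath (p + a *s v) (p + a *s v)) (\<lambda>_. u)" for u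
  proof -
    have "conn_form \<H> h A x 0 w = 0" for x w
      unfolding conn_form_def by (intro sum.neutral) (simp add: form_zero[OF equation_linear[OF arr]])
    then show ?thesis
      unfolding parallel_along_def by (auto simp: linepath_refl intro!: exI[of _ "{}"])
  qed
  moreover have "p + a *s v \<in> complement \<H>" using start line_in_complement by blast
  ultimately have "path_image (linepath (p + a *s v) (p + a *s v)) \<subseteq> complement \<H> \<and>
      (\<forall>u. \<exists>s. parallel_along \<H> h A (linepath (p + a *s v) (p + a *s v)) s \<and> s 0 = u \<and> s 1 = u)"
    unfolding path_image_linepath closed_segment_idem by blast
  then show ?case
    unfolding matrix_vector_mul_lid using valid_path_linepath pathstart_linepath pathfinish_linepath by blast
next
  case (step M b D c \<Phi> \<Psi>)
  then obtain \<gamma> where \<gamma>: "valid_path \<gamma>" "path_image \<gamma> \<subseteq> complement \<H>" "pathstart \<gamma> = p + a *s v" "pathfinish \<gamma> = p + b *s v"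
    and par: "\<And>u. \<exists>s. parallel_along \<H> h A \<gamma> s \<and> s 0 = u \<and> s 1 = M *v u" by blast
  let ?l = "linepath (p + b *s v) (p + c *s v)"
  have "path_image ?l \<subseteq> complement \<H>"
  proof
    fix x assume "x \<in> path_image ?l"
    then obtain \<tau> where \<tau>: "\<tau> \<in> {0..1}" "x = ?l \<tau>" by (auto simp: path_image_def)
    have "x = p + ((1 - \<tau>) *\<^sub>R b + \<tau> *\<^sub>R c) *s v"
      unfolding \<tau>(2) linepath_def scaleR_vec_eq by (simp add: vec_eq_iff algebra_simps scaleR_conv_of_real)
    moreover have "(1 - \<tau>) *\<^sub>R b + \<tau> *\<^sub>R c \<in> D" using step.hyps \<tau> by (intro convexD) auto
    ultimately show "x \<in> complement \<H>" using step.hyps line_in_complement by blast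
  qed
  then have "path_image (\<gamma> +++ ?l) \<subseteq> complement \<H>" using \<gamma>(2) path_image_join_subset by blast
  moreover have "valid_path (\<gamma> +++ ?l)" using \<gamma> by (intro valid_path_join) auto
  moreover have "\<exists>s. parallel_along \<H> h A (\<gamma> +++ ?l) s \<and> s 0 = u \<and> s 1 = (\<Phi> c ** \<Psi> b ** M) *v u" for u
  proof -
    obtain s1 where s1: "parallel_along \<H> h A \<gamma> s1" "s1 0 = u" "s1 1 = M *v u" using par by blast
    obtain s2 where s2: "parallel_along \<H> h A ?l s2" "s2 0 = M *v u" "s2 1 = (\<Phi> c ** \<Psi> b) *v (M *v u)"
      using transport_segment_parallel[of D b c \<Phi> \<Psi> "M *v u"] step.hyps by blast
    have "parallel_along \<H> h A (\<gamma> +++ ?l) (s1 +++ s2)"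
      using s1 s2 by (intro parallel_along_join) auto
    moreover have "(s1 +++ s2) 0 = u" "(s1 +++ s2) 1 = (\<Phi> c ** \<Psi> b ** M) *v u"
      using s1 s2 by (simp_all add: joinpaths_def matrix_vector_mul_assoc)
    ultimately show ?thesis by blast
  qed
  ultimately show ?case using \<gamma> by (intro exI[of _ "\<gamma> +++ ?l"]) auto
qed

lemma loop_transport_holonomy:
  assumes "transport (line_connection \<H> A t) (UNIV - t ` \<H>) 0 M 0"
  shows "(\<lambda>u. M *v u) \<in> holonomies \<H> h A p"
  using transport_realised_by_path[OF assms] unfolding holonomies_def by auto

context
  fixes g :: "complex^'n \<Rightarrow> complex^'n \<Rightarrow> complex^'n \<Rightarrow> complex"
  assumes metric: "hermitian_metric_on (complement \<H>) g" and par: "parallel_metric \<H> h A g"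
    and nonempty: "\<H> \<noteq> {}"
begin

text \<open>\<open>\<nabla> g = 0\<close> is a statement about vector fields on open subsets of the ambient space. A parallel section \<open>\<Phi> u\<close> on the line
  is extended to such a field by composing with an affine projection onto the line; along the
  line and in its direction the extension is covariantly constant, so the inner product of two such fields
  has derivative \<open>0\<close> there.\<close>

lemma frame_isometry:
  assumes D: "convex D" "open D" "D \<subseteq> UNIV - t ` \<H>" and fr: "flat_frame (line_connection \<H> A t) D \<Phi> \<Psi>"
    and bc: "b \<in> D" "c \<in> D"
  shows "g (p + b *s v) (\<Phi> b *v u) (\<Phi> b *v w) = g (p + c *s v) (\<Phi> c *v u) (\<Phi> c *v w)"
proof -
  obtain H where H: "H \<in> \<H>" using nonempty by blast
  note lH = equation_linear[OF arr H]
  \<comment> \<open>Any member \<open>H\<close> of the arrangement gives a coordinate \<open>l\<close> on the line, defined on the whole space.\<close>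
  define l where "l = (\<lambda>x. h H (x - p) / h H v)"
  have l_line: "l (p + z *s v) = z" for z
    using v[OF H] by (simp add: l_def form_scale[OF lH])
  have l_deriv: "(l has_derivative (\<lambda>d. h H d / h H v)) (at x)" for x
  proof -
    have "((\<lambda>x. x - p) has_derivative (\<lambda>d. d)) (at x)" by (auto intro!: derivative_eq_intros)
    from bounded_linear.has_derivative[OF equation_bounded_linear[OF arr H] this]
    show ?thesis
      unfolding l_def divide_inverse by (rule has_derivative_mult_left)
  qed
  define U where "U = complement \<H> \<inter> l -` D"
  have "continuous_on UNIV l"
    by (intro continuous_at_imp_continuous_on ballI) (rule has_derivative_continuous[OF l_deriv])
  then have U: "open U" "U \<subseteq> complement \<H>"
    unfolding U_def using open_complement[OF arr] D(2) by (auto intro!: open_Int open_vimage)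
  define X where "X = (\<lambda>u x. \<Phi> (l x) *v u)"
  have X_deriv: "(X u has_derivative (\<lambda>d. (h H d / h H v) *s ((line_connection \<H> A t (l x) ** \<Phi> (l x)) *v u))) (at x)"
    if "l x \<in> D" for u x
  proof -
    have "mat_deriv \<Phi> (line_connection \<H> A t (l x) ** \<Phi> (l x)) (l x)"
      using fr that unfolding flat_frame_def by blast
    from has_derivative_compose[OF l_deriv vec_deriv_has_derivative[OF mat_deriv_vec[OF this, of u]]]
    show ?thesis by (simp add: X_def)
  qed
  have X_hol: "holomorphic_field_on U (X u)" for u
    unfolding holomorphic_field_on_def
  proof
    fix x assume "x \<in> U"
    then have "l x \<in> D" by (simp add: U_def)
    moreover have "Vector_Spaces.linear (*s) (*s) (\<lambda>d. (h H d / h H v) *s y)" for y :: "complex^'n"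
      by (rule vec_linearI)
        (simp_all add: form_add[OF lH] form_scale[OF lH] add_divide_distrib vec_eq_iff distrib_right)
    ultimately show "\<exists>D. (X u has_derivative D) (at x) \<and> Vector_Spaces.linear (*s) (*s) D"
      using X_deriv by blast
  qed
  have nabla0: "nabla \<H> h A (\<lambda>_. \<zeta> *s v) (X u) (p + z *s v) = 0" if "z \<in> D" for \<zeta> u z
  proof -
    have "frechet_derivative (X u) (at (p + z *s v)) = (\<lambda>d. (h H d / h H v) *s ((line_connection \<H> A t z ** \<Phi> z) *v u))"
      using frechet_derivative_at[OF X_deriv[of "p + z *s v" u]] that by (simp add: l_line)
    then show ?thesis
      using v[OF H] unfolding nabla_def conn_form_line
      by (simp add: form_scale[OF lH] X_def l_line matrix_vector_mul_assoc)
  qed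
  define Q where "Q = (\<lambda>y. g y (X u y) (X w y))"
  have herm: "hermitian_inner_product (g x)" if "x \<in> complement \<H>" for x
    using metric that unfolding hermitian_metric_on_def by blast
  have Q_diff: "Q differentiable (at x)" if x: "x \<in> U" for x
  proof -
    have g_diff: "(\<lambda>y. g y e e') differentiable (at x)" for e e'
    proof -
      have "Ck_on (Suc 0) (complement \<H>) (\<lambda>y. g y e e')"
        using metric unfolding hermitian_metric_on_def smooth_on_def by blast
      then show ?thesis using x U(2) by auto
    qed
    have Xd: "(\<lambda>y. X u y $ i) differentiable (at x)" for u i
      using bounded_linear.has_derivative[OF bounded_linear_vec_nth X_deriv[of x u]] x
      unfolding differentiable_def U_def by blast
    have cnjd: "(\<lambda>y. cnj (X u y $ i)) differentiable (at x)" for u i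
      using Xd[of u i] bounded_linear.has_derivative[OF bounded_linear_cnj] unfolding differentiable_def by blast
    define R where "R = (\<lambda>y. \<Sum>i\<in>UNIV. \<Sum>j\<in>UNIV. X u y $ i * cnj (X w y $ j) * g y (axis i 1) (axis j 1))"
    have "R differentiable (at x)"
      unfolding R_def by (intro differentiable_sum differentiable_mult Xd cnjd g_diff ballI finite)
    then obtain D' where "(R has_derivative D') (at x)"
      unfolding differentiable_def by blast
    then have "(Q has_derivative D') (at x)"
    proof (rule has_derivative_transform_within_open[OF _ U(1) x])
      fix y assume "y \<in> U"
      then have "hermitian_inner_product (g y)" using herm U(2) by blast
      then show "R y = Q y" unfolding R_def Q_def by (rule hermitian_expand[symmetric])
    qed
    then show ?thesis unfolding differentiable_def by blast
  qed
  have "((\<lambda>z. Q (p + z *s v)) has_derivative (\<lambda>_. 0)) (at z within D)" if z: "z \<in> D" for z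
  proof -
    have zU: "p + z *s v \<in> U" using z D(3) line_in_complement by (auto simp: U_def l_line)
    have "((\<lambda>z. p + z *s v) has_derivative (\<lambda>d. d *s v)) (at z)"
      using bounded_linear.has_derivative[OF bounded_linear_smult_left[of v] has_derivative_ident]
      by (auto intro!: derivative_eq_intros)
    moreover have "(Q has_derivative frechet_derivative Q (at (p + z *s v))) (at (p + z *s v))"
      using Q_diff[OF zU] by (simp add: frechet_derivative_works)
    ultimately have "((\<lambda>z. Q (p + z *s v)) has_derivative (\<lambda>d. frechet_derivative Q (at (p + z *s v)) (d *s v))) (at z)"
      by (rule has_derivative_compose)
    moreover have "frechet_derivative Q (at (p + z *s v)) (d *s v) = 0" for d
    proof -
      have "frechet_derivative Q (at (p + z *s v)) (d *s v) =
         g (p + z *s v) (nabla \<H> h A (\<lambda>_. d *s v) (X u) (p + z *s v)) (X w (p + z *s v)) +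
         g (p + z *s v) (X u (p + z *s v)) (nabla \<H> h A (\<lambda>_. d *s v) (X w) (p + z *s v))"
        using par U X_hol zU unfolding parallel_metric_def Q_def by blast
      also have "\<dots> = 0"
        using zU U(2) unfolding nabla0[OF z] by (simp add: hermitian_inner_product_simps[OF herm] subsetD)
      finally show ?thesis .
    qed
    ultimately show ?thesis by (simp add: has_derivative_at_withinI)
  qed
  then obtain k where "\<And>z. z \<in> D \<Longrightarrow> Q (p + z *s v) = k"
    using has_derivative_zero_constant[OF D(1)] by metis
  then have "Q (p + b *s v) = Q (p + c *s v)" using bc by simp
  then show ?thesis by (simp add: Q_def X_def l_line)
qed

lemma transport_isometry:
  assumes "transport (line_connection \<H> A t) (UNIV - t ` \<H>) a M b"
  shows "g (p + b *s v) (M *v u) (M *v w) = g (p + a *s v) u w"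
  using assms
proof (induction rule: transport.induct)
  case (step M b D c \<Phi> \<Psi>)
  have "\<Phi> b ** \<Psi> b = mat 1" using step.hyps unfolding flat_frame_def by blast
  then have i: "\<Phi> b *v (\<Psi> b *v x) = x" for x by (simp add: matrix_vector_mul_assoc)
  have "g (p + c *s v) ((\<Phi> c ** \<Psi> b ** M) *v u) ((\<Phi> c ** \<Psi> b ** M) *v w) =
      g (p + c *s v) (\<Phi> c *v (\<Psi> b *v (M *v u))) (\<Phi> c *v (\<Psi> b *v (M *v w)))"
    by (simp add: matrix_vector_mul_assoc matrix_mul_assoc)
  also have "\<dots> = g (p + b *s v) (M *v u) (M *v w)"
    using frame_isometry[of D \<Phi> \<Psi> c b "\<Psi> b *v (M *v u)" "\<Psi> b *v (M *v w)"] step.hyps by (simp add: i)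
  finally show ?case using step.IH by simp
qed simp

text \<open>A holonomy and its inverse are isometries mapping \<open>W\<close> to itself, hence preserve the orthogonal
  complement of \<open>W\<close> as well.\<close>

lemma projection_commutes_with_holonomy:
  assumes W: "vec.subspace W" and inv: "\<And>T. T \<in> holonomies \<H> h A p \<Longrightarrow> T ` W \<subseteq> W"
    and p: "p \<in> complement \<H>"
  obtains P :: "complex^'n^'n" where "\<And>x. P *v x \<in> W" "\<And>x. x \<in> W \<Longrightarrow> P *v x = x"
    "\<And>M. transport (line_connection \<H> A t) (UNIV - t ` \<H>) 0 M 0 \<Longrightarrow> M ** P = P ** M"
proof -
  have herm: "hermitian_inner_product (g p)"
    using metric p unfolding hermitian_metric_on_def by blast
  obtain P :: "complex^'n^'n" where P: "\<And>x. P *v x \<in> W" "\<And>x. x \<in> W \<Longrightarrow> P *v x = x"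
    "\<And>x. (\<And>w. w \<in> W \<Longrightarrow> g p x w = 0) \<Longrightarrow> P *v x = 0"
    "\<And>x w. w \<in> W \<Longrightarrow> g p (x - P *v x) w = 0"
    using orthogonal_projection[OF herm W] by blast
  show ?thesis
  proof (rule that[OF P(1,2)])
    fix M assume M: "transport (line_connection \<H> A t) (UNIV - t ` \<H>) 0 M 0"
    obtain N where N: "transport (line_connection \<H> A t) (UNIV - t ` \<H>) 0 N 0" "M ** N = mat 1"
      using transport_inverse[OF M] by blast
    have MW: "M *v w \<in> W" "N *v w \<in> W" if "w \<in> W" for w
      using inv[OF loop_transport_holonomy[OF M]] inv[OF loop_transport_holonomy[OF N(1)]] that by auto
    have "M *v (P *v x) = P *v (M *v x)" for x
    proof -
      have "g p (M *v (x - P *v x)) w = 0" if w: "w \<in> W" for w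
      proof -
        have "g p (M *v (x - P *v x)) w = g p (M *v (x - P *v x)) (M *v (N *v w))"
          by (simp add: matrix_vector_mul_assoc N(2))
        also have "\<dots> = g p (x - P *v x) (N *v w)"
          using transport_isometry[OF M] by simp
        finally show ?thesis using P(4) MW(2)[OF w] by simp
      qed
      then have "P *v (M *v (x - P *v x)) = 0" by (rule P(3))
      then have "P *v (M *v x) = P *v (M *v (P *v x))"
        by (simp add: matrix_vector_mult_diff_distrib)
      also have "\<dots> = M *v (P *v x)" using P(1) MW(1) P(2) by blast
      finally show ?thesis by simp
    qed
    then show "M ** P = P ** M" by (simp add: matrix_eq matrix_vector_mul_assoc[symmetric])
  qed
qed

end
end
end

section \<open>Irreducibility of the holonomy\<close>

theorem theorem1p4:
  fixes \<H> :: "(complex^'n) set set"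
    and h :: "(complex^'n) set \<Rightarrow> complex^'n \<Rightarrow> complex"
    and A :: "(complex^'n) set \<Rightarrow> complex^'n^'n"
    and g :: "complex^'n \<Rightarrow> complex^'n \<Rightarrow> complex^'n \<Rightarrow> complex"
    and p :: "complex^'n"
  assumes "arrangement \<H> h"
    and "essential \<H>"
    and "irreducible_arrangement h \<H>"
    and "flat_connection \<H> h A"
    and "torsion_free \<H> h A"
    and "unitary_connection \<H> h A"
    and "kaehler_metric_on (complement \<H>) g"
    and "parallel_metric \<H> h A g"
    and "\<And>L. L \<in> irreducible_intersections \<H> h \<Longrightarrow> weight \<H> A L \<notin> \<int> \<and> 0 < 1 - weight \<H> A L"
    and "p \<in> complement \<H>"
  shows "irreducible_holonomy \<H> h A p"
  unfolding irreducible_holonomy_def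
proof (rule notI, elim exE conjE)
  fix W :: "(complex^'n) set"
  assume W: "vec.subspace W" "W \<noteq> {0}" "W \<noteq> UNIV" and inv: "\<forall>T\<in>holonomies \<H> h A p. T ` W \<subseteq> W"
  note arr = assms(1) and ess = assms(2) and irr = assms(3) and p = assms(10)
  have fin: "finite \<H>" by (rule finite_arrangement[OF arr])
  have "\<Inter>\<H> \<noteq> UNIV" using ess W(2,3) unfolding essential_def by (metis UNIV_I singletonD UNIV_eq_I vec.subspace_0 W(1) singletonI)
  then have nonempty: "\<H> \<noteq> {}" by auto
  obtain n where n: "\<And>H w. H \<in> \<H> \<Longrightarrow> A H *v w = h H w *s n H"
    and tr: "\<And>H. H \<in> \<H> \<Longrightarrow> h H (n H) = trace (A H)"
    using residue_rank_one[OF arr assms(5)] by blast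
  have nonint: "h H (n H) \<notin> \<int>" if "H \<in> \<H>" for H
    using assms(9)[OF hyperplane_irreducible_intersection(1)[OF arr that]] tr[OF that]
    by (simp add: weight_hyperplane[OF arr that])
  have n0: "h H (n H) \<noteq> 0" if "H \<in> \<H>" for H using nonint[OF that] by auto
  obtain a0 where a0: "\<And>x. (\<Sum>H\<in>\<H>. A H) *v x = a0 *s x"
    using commutant_scalar[OF arr ess irr n n0] flat_residue_commutes[OF arr assms(4)] by blast
  \<comment> \<open>The residue at infinity of the adjoint system vanishes.\<close>
  have A0_comm: "(\<Sum>H\<in>\<H>. A H) ** X = X ** (\<Sum>H\<in>\<H>. A H)" for X
    by (simp add: matrix_eq matrix_vector_mul_assoc[symmetric] a0 vector_scalar_commute)
  obtain v t where v: "\<And>H. H \<in> \<H> \<Longrightarrow> h H v \<noteq> 0" and inj: "inj_on t \<H>"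
    and line: "\<And>H z. H \<in> \<H> \<Longrightarrow> h H (p + z *s v) = h H v * (z - t H)"
    using generic_line[OF arr p] by blast
  have t0: "0 \<notin> t ` \<H>"
    using line_in_complement[OF arr v line, of 0] p by simp
  have metric: "hermitian_metric_on (complement \<H>) g" using assms(7) by (simp add: kaehler_metric_on_def)
  obtain P0 where P0: "\<And>x. P0 *v x \<in> W" "\<And>x. x \<in> W \<Longrightarrow> P0 *v x = x"
    "\<And>M. transport (line_connection \<H> A t) (UNIV - t ` \<H>) 0 M 0 \<Longrightarrow> M ** P0 = P0 ** M"
    using projection_commutes_with_holonomy[OF arr v line metric assms(8) nonempty W(1) _ p] inv
    by metis
  have comm: "P0 ** A H = A H ** P0" if "H \<in> \<H>" for H
    by (rule monodromy_commutant_commutes_with_residues[OF fin inj t0 equation_linear[OF arr] n nonint A0_comm P0(3) that])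
  obtain c where c: "\<And>x. P0 *v x = c *s x"
    using commutant_scalar[OF arr ess irr n n0 comm] by blast
  obtain w where w: "w \<in> W" "w \<noteq> 0" using W(1,2) vec.subspace_0 by blast
  \<comment> \<open>A scalar projection fixing a non-zero vector is the identity.\<close>
  have "c *s w = 1 *s w" using P0(2)[OF w(1)] c by simp
  then have "c = 1" using w(2) by (simp only: vec.scale_right_imp_eq vec.scale_cancel_right) simp
  then have "x \<in> W" for x using P0(1)[of x] c by simp
  then show False using W(3) by blast
qed

end
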